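(* Let $n_1,n_2,n_3$ be positive integers and $a>0$ a real number. Let $\mathcal{F}_1$ be the free linkage in the plane with $n_1$ edges of lengths $(a,1,\ldots,1)$ (one edge of length $a$, placed first, followed by $n_1-1$ edges of length $1$), let $\mathcal{F}_2$ be the free linkage with $n_2$ edges all of length $1$, and let $\mathcal{F}_3$ be the free linkage with $n_3$ edges all of length $1$. Suppose that (1) $n_2$ and $n_3$ do not have the same parity, and (2) $a\in(0,b)\setminus\mathbb{Z}$, where $b=\min\{n_2,n_3\}$. Then the moduli space $M(\mathcal{F}_1,\mathcal{F}_2,\mathcal{F}_3)$ is a smooth manifold of dimension $n_1+n_2+n_3-5$.
   Context: A free linkage in $\mathbb{R}^2$ with length vector $(d_1,\ldots,d_n)$, $d_i>0$, has configurations $(x_1,\ldots,x_{n+1})\in(\mathbb{R}^2)^{n+1}$ with $|x_i-x_{i+1}|=d_i$ for $i=1,\ldots,n$; $x_1$ is the initial and $x_{n+1}$ the terminal vertex. $C(\mathcal{F}_1,\mathcal{F}_2,\mathcal{F}_3)$ is the space of triples of configurations of $\mathcal{F}_1,\mathcal{F}_2,\mathcal{F}_3$ with all initial vertices at the origin and all terminal vertices coinciding, and $M(\mathcal{F}_1,\mathcal{F}_2,\mathcal{F}_3)=C(\mathcal{F}_1,\mathcal{F}_2,\mathcal{F}_3)/SO(2)$. It is identified with the set of triples in which the first edge of $\mathcal{F}_1$ lies on the positive $x$-axis. Equivalently, writing $\theta_{i,j}$ for the angle from the positive $x$-axis to the $i$-th edge of $\mathcal{F}_j$ (each $\theta_{i,j}\in\mathbb{R}/2\pi\mathbb{Z}$,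 with $\theta_{1,1}=0$), it is the zero set, in the torus of the remaining angle variables, of the equations saying that the sum of the edge vectors of $\mathcal{F}_1$ equals the sum of the edge vectors of $\mathcal{F}_2$ and equals the sum of the edge vectors of $\mathcal{F}_3$. *)

theory Defs
  imports "HOL-Analysis.Analysis"
begin

section \<open>Smooth manifolds\<close>

text \<open>
  For open \<open>S\<close> in finite dimension this is \<open>C\<^sup>k\<close>: the derivative is \<open>C\<^sup>k\<close> iff each of its values
  on a fixed direction \<open>v\<close> is.
\<close>

primrec ck_on :: "nat \<Rightarrow> 'a::euclidean_space set \<Rightarrow> ('a \<Rightarrow> 'b::euclidean_space) \<Rightarrow> bool" where
  "ck_on 0 S f \<longleftrightarrow> continuous_on S f"
| "ck_on (Suc k) S f \<longleftrightarrow> (\<forall>x\<in>S. f differentiable (at x)) \<and>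
     (\<forall>v. ck_on k S (\<lambda>x. frechet_derivative f (at x) v))"

definition smooth_on :: "'a::euclidean_space set \<Rightarrow> ('a \<Rightarrow> 'b::euclidean_space) \<Rightarrow> bool" where
  "smooth_on S f \<longleftrightarrow> (\<forall>k. ck_on k S f)"

definition diffeomorphism ::
  "'a::euclidean_space set \<Rightarrow> 'b::euclidean_space set \<Rightarrow> ('a \<Rightarrow> 'b) \<Rightarrow> ('b \<Rightarrow> 'a) \<Rightarrow> bool" where
  "diffeomorphism U V h g \<longleftrightarrow>
     open U \<and> open V \<and> homeomorphism U V h g \<and> smooth_on U h \<and> smooth_on V g"

text \<open>
  Embedded submanifolds of a Euclidean space, by slice charts. The dimension is an integer, so that
  dimension formulas need no truncated subtraction; the empty set is a submanifold of every
  dimension, and the only one of negative dimension.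
\<close>

definition smooth_submanifold :: "'a::euclidean_space set \<Rightarrow> int \<Rightarrow> bool" where
  "smooth_submanifold M k \<longleftrightarrow>
     (\<forall>p\<in>M. \<exists>U (V :: 'a set) h g L. p \<in> U \<and> diffeomorphism U V h g \<and>
        subspace L \<and> int (dim L) = k \<and> h ` (M \<inter> U) = L \<inter> V)"

text \<open>
  The space \<open>X\<close>, with the smooth structure pulled back along the identification \<open>\<phi>\<close> of \<open>X\<close> with a
  subspace of a Euclidean space, is a smooth manifold of dimension \<open>k\<close>.
\<close>

definition smooth_manifold_via ::
  "'p topology \<Rightarrow> ('p \<Rightarrow> 'a::euclidean_space) \<Rightarrow> int \<Rightarrow> bool" where
  "smooth_manifold_via X \<phi> k \<longleftrightarrow>
     embedding_map X euclidean \<phi> \<and> smooth_submanifold (\<phi> ` topspace X) k"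

definition quotient_topology :: "'a topology \<Rightarrow> ('a \<Rightarrow> 'b) \<Rightarrow> 'b topology" where
  "quotient_topology X f =
     topology (\<lambda>U. U \<subseteq> f ` topspace X \<and> openin X {x \<in> topspace X. f x \<in> U})"

lemma openin_quotient_topology:
  "openin (quotient_topology X f) U \<longleftrightarrow>
     U \<subseteq> f ` topspace X \<and> openin X {x \<in> topspace X. f x \<in> U}"
proof -
  let ?P = "\<lambda>U. U \<subseteq> f ` topspace X \<and> openin X {x \<in> topspace X. f x \<in> U}"
  have "?P (S \<inter> T)" if "?P S" "?P T" for S T
  proof -
    have "{x \<in> topspace X. f x \<in> S \<inter> T} =
        {x \<in> topspace X. f x \<in> S} \<inter> {x \<in> topspace X. f x \<in> T}" by auto
    with that show ?thesis by auto
  qed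
  moreover have "?P (\<Union>K)" if "\<forall>S\<in>K. ?P S" for K
  proof -
    have "{x \<in> topspace X. f x \<in> \<Union>K} = (\<Union>S\<in>K. {x \<in> topspace X. f x \<in> S})" by auto
    with that show ?thesis by auto
  qed
  ultimately have "istopology ?P" unfolding istopology_def by blast
  then show ?thesis unfolding quotient_topology_def by simp
qed

lemma topspace_quotient_topology: "topspace (quotient_topology X f) = f ` topspace X"
proof
  show "topspace (quotient_topology X f) \<subseteq> f ` topspace X"
    using openin_quotient_topology openin_topspace by metis
  have "{x \<in> topspace X. f x \<in> f ` topspace X} = topspace X" by auto
  then have "openin (quotient_topology X f) (f ` topspace X)"
    by (simp add: openin_quotient_topology)
  then show "f ` topspace X \<subseteq> topspace (quotient_topology X f)"
    by (rule openin_subset)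
qed

lemma quotient_map_quotient_topology: "quotient_map X (quotient_topology X f) f"
  by (auto simp: quotient_map_def topspace_quotient_topology openin_quotient_topology)


section \<open>Linkages\<close>

text \<open>
  A free linkage with \<open>n\<close> edges is given by the list \<open>d\<close> of its lengths. Its vertices are indexed by
  a finite linearly ordered type \<open>'v\<close> with \<open>n + 1\<close> elements, and \<open>vertex 0, \<dots>, vertex n\<close> are these
  in increasing order, so \<open>vertex i\<close> is the index of \<open>x\<close> with subscript \<open>i + 1\<close>. Since \<open>n\<close> is
  arbitrary, the type is, too; all uses below are under \<open>CARD('v) = length d + 1\<close>.
\<close>

definition vertex :: "nat \<Rightarrow> 'v::{finite,linorder}" where
  "vertex i = sorted_list_of_set UNIV ! i"

definition configurations :: "real list \<Rightarrow> ((real^2)^'v::{finite,linorder}) set" where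
  "configurations d =
     {x. \<forall>i<length d. dist (x $ vertex i) (x $ vertex (Suc i)) = d ! i}"

definition initial_vertex :: "(real^2)^'v::{finite,linorder} \<Rightarrow> real^2" where
  "initial_vertex x = x $ vertex 0"

definition terminal_vertex :: "real list \<Rightarrow> (real^2)^'v::{finite,linorder} \<Rightarrow> real^2" where
  "terminal_vertex d x = x $ vertex (length d)"

type_synonym ('u, 'v, 'w) triple = "((real^2)^'u) \<times> ((real^2)^'v) \<times> ((real^2)^'w)"

definition configuration_space ::
  "real list \<Rightarrow> real list \<Rightarrow> real list \<Rightarrow>
     ('u::{finite,linorder}, 'v::{finite,linorder}, 'w::{finite,linorder}) triple set" where
  "configuration_space d1 d2 d3 =
     {(x, y, z). x \<in> configurations d1 \<and> y \<in> configurations d2 \<and> z \<in> configurations d3 \<and>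
        initial_vertex x = 0 \<and> initial_vertex y = 0 \<and> initial_vertex z = 0 \<and>
        terminal_vertex d1 x = terminal_vertex d2 y \<and>
        terminal_vertex d2 y = terminal_vertex d3 z}"

definition rotate_triple :: "real^2^2 \<Rightarrow>
     ('u::finite, 'v::finite, 'w::finite) triple \<Rightarrow> ('u, 'v, 'w) triple" where
  "rotate_triple A = (\<lambda>(x, y, z). (\<chi> i. A *v x $ i, \<chi> i. A *v y $ i, \<chi> i. A *v z $ i))"

definition SO2_orbit ::
  "('u::finite, 'v::finite, 'w::finite) triple \<Rightarrow> ('u, 'v, 'w) triple set" where
  "SO2_orbit p = {rotate_triple A p | A. rotation_matrix A}"

definition moduli_space ::
  "real list \<Rightarrow> real list \<Rightarrow> real list \<Rightarrow>
     ('u::{finite,linorder}, 'v::{finite,linorder}, 'w::{finite,linorder}) triple set topology" where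
  "moduli_space d1 d2 d3 =
     quotient_topology (top_of_set (configuration_space d1 d2 d3)) SO2_orbit"

definition first_edge_on_positive_x_axis ::
  "('u::{finite,linorder}, 'v::finite, 'w::finite) triple \<Rightarrow> bool" where
  "first_edge_on_positive_x_axis = (\<lambda>(x, y, z).
     let e = x $ vertex 1 - x $ vertex 0 in e $ 1 > 0 \<and> e $ 2 = 0)"

text \<open>
  The identification of the moduli space with the set of those triples in which the first edge of
  the first linkage lies on the positive \<open>x\<close>-axis: every orbit contains exactly one such triple,
  because that edge has positive length.
\<close>

definition normal_form ::
  "('u::{finite,linorder}, 'v::finite, 'w::finite) triple set \<Rightarrow> ('u, 'v, 'w) triple" where
  "normal_form Q = (THE p. p \<in> Q \<and> first_edge_on_positive_x_axis p)"

end

theory Submission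
  imports Defs
begin

text \<open>
  The moduli space is, inside an open set, the common zero set of finitely many polynomials, and the
  proof is the implicit function theorem (\<open>smooth_submanifold_regular_zero_set\<close>): it suffices that
  these polynomials have linearly independent differentials at every common zero.

  Rotating a configuration until its first edge points along the positive axis picks one point of
  each orbit, continuously, so \<open>normal_form\<close> embeds the moduli space, with the normalised
  configurations as its image (\<open>moduli_space_normal_form\<close>). Inside the space of all triples of
  vertex positions, normalised configurations are cut out by one equation for the length of each edge,
  six for the initial vertices, four for the coincidence of the terminal vertices, and one for the
  direction of the first edge. That makes \<open>n1 + n2 + n3 + 11\<close> equations in
  \<open>2 * (n1 + n2 + n3 + 3)\<close> unknowns, whence the dimension.

  A linear dependence between the differentials is a self-stress of the framework. Moving the part of
  one linkage that follows a given edge rigidly by a vector \<open>w\<close>, while everything else stays put,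
  shows that the force carried by the edges of a linkage is constant along the linkage. If \<open>\<alpha>\<close> and
  \<open>\<beta>\<close> are the multipliers of the two closing conditions, the edges of the second linkage carry
  \<open>\<alpha> - \<beta>\<close>, those of the third carry \<open>\<beta>\<close>, and those of the first linkage after its first edge
  carry \<open>- \<alpha>\<close>; as the force is along the edge, a linkage that carries a nonzero force is straight
  (up to folding), apart from the first edge of the first linkage. So a smoothness theorem holds for
  all triples of linkages in which such forces vanish (\<open>smooth_manifold_via_moduli_space\<close>).

  For the given lengths a nonzero pair \<open>(\<alpha>, \<beta>)\<close> is impossible. If \<open>\<alpha> - \<beta>\<close> and \<open>\<beta>\<close> are
  nonzero, the second and third linkages are both folded along lines, so their terminal vertices are at
  integer distances from the origin with the parities of \<open>n2\<close> and of \<open>n3\<close>; these parities differ,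
  whereas the terminal vertices coincide. Otherwise \<open>\<alpha>\<close> is nonzero and one of these two linkages is
  folded along the line spanned by \<open>\<alpha>\<close>, like the unit edges of the first linkage. The remaining
  edge, of length \<open>a\<close>, is then an integer multiple of the unit vector along that line, and \<open>a\<close>
  would be an integer.
\<close>

section \<open>Calculus of k times continuously differentiable maps\<close>

lemma ck_on_cong:
  assumes "open S" "\<And>x. x \<in> S \<Longrightarrow> f x = g x" "ck_on k S f"
  shows "ck_on k S g"
  using assms(2,3)
proof (induction k arbitrary: f g)
  case 0
  then show ?case by (simp add: continuous_on_eq)
next
  case (Suc k)
  have *: "(g has_derivative frechet_derivative f (at x)) (at x)" if "x \<in> S" for x
    using Suc.prems that assms(1)
    by (auto simp: frechet_derivative_works intro: has_derivative_transform_within_open)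
  have "ck_on k S (\<lambda>x. frechet_derivative g (at x) v)" for v
  proof (rule Suc.IH)
    show "ck_on k S (\<lambda>x. frechet_derivative f (at x) v)" using Suc.prems by simp
    show "\<And>x. x \<in> S \<Longrightarrow> frechet_derivative f (at x) v = frechet_derivative g (at x) v"
      using frechet_derivative_at[OF *] by simp
  qed
  then show ?case using * by (auto intro: differentiableI)
qed

text \<open>
  For open sets the recursion in \<open>ck_on\<close> may be run with any family of derivatives in place of the
  chosen \<open>frechet_derivative\<close>; this turns each rule of differentiation into a rule for \<open>ck_on\<close>.
\<close>

lemma ck_on_SucI:
  assumes "open S" "\<And>x. x \<in> S \<Longrightarrow> (f has_derivative f' x) (at x)"
    and "\<And>v. ck_on k S (\<lambda>x. f' x v)"
  shows "ck_on (Suc k) S f"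
proof -
  have "ck_on k S (\<lambda>x. frechet_derivative f (at x) v)" for v
    by (rule ck_on_cong[OF assms(1) _ assms(3)[of v]])
      (use frechet_derivative_at[OF assms(2)] in simp)
  then show ?thesis using assms(2) by (auto intro: differentiableI)
qed

lemma ck_on_Suc_has_derivative:
  "ck_on (Suc k) S f \<Longrightarrow> x \<in> S \<Longrightarrow> (f has_derivative frechet_derivative f (at x)) (at x)"
  by (simp add: frechet_derivative_works)

lemma ck_on_SucD: "ck_on (Suc k) S f \<Longrightarrow> ck_on k S f"
proof (induction k arbitrary: f)
  case 0
  then show ?case
    by (auto intro!: continuous_at_imp_continuous_on differentiable_imp_continuous_within)
next
  case (Suc k)
  then show ?case by fastforce
qed

lemma ck_on_imp_continuous_on: "ck_on k S f \<Longrightarrow> continuous_on S f"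
  by (induction k) (simp, blast dest: ck_on_SucD)

lemma ck_on_subset: "ck_on k S f \<Longrightarrow> T \<subseteq> S \<Longrightarrow> ck_on k T f"
  by (induction k arbitrary: f) (auto intro: continuous_on_subset)

lemma ck_on_const: "ck_on k S (\<lambda>x. c)"
  by (induction k arbitrary: c) auto

lemma ck_on_bounded_linear:
  assumes "open S" "bounded_linear L" shows "ck_on k S L"
proof (cases k)
  case 0
  then show ?thesis using assms(2) by (simp add: linear_continuous_on)
next
  case (Suc m)
  show ?thesis unfolding Suc
    by (rule ck_on_SucI[OF assms(1) bounded_linear_imp_has_derivative[OF assms(2)] ck_on_const])
qed

lemma ck_on_add:
  assumes "open S" "ck_on k S f" "ck_on k S g"
  shows "ck_on k S (\<lambda>x. f x + g x)"
  using assms(2,3)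
proof (induction k arbitrary: f g)
  case 0
  then show ?case by (auto intro: continuous_intros)
next
  case (Suc k)
  show ?case
    by (rule ck_on_SucI[OF assms(1) has_derivative_add
          [OF ck_on_Suc_has_derivative[OF Suc.prems(1)] ck_on_Suc_has_derivative[OF Suc.prems(2)]]])
      (use Suc in auto)
qed

lemma ck_on_sum:
  assumes "open S" "\<And>i. i \<in> I \<Longrightarrow> ck_on k S (f i)"
  shows "ck_on k S (\<lambda>x. \<Sum>i\<in>I. f i x)"
  using assms(2)
  by (induction I rule: infinite_finite_induct) (auto intro: ck_on_const ck_on_add[OF assms(1)])

lemma ck_on_bounded_bilinear:
  assumes "bounded_bilinear B" "open S" "ck_on k S f" "ck_on k S g"
  shows "ck_on k S (\<lambda>x. B (f x) (g x))"
  using assms(3,4)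
proof (induction k arbitrary: f g)
  case 0
  then show ?case by (auto intro: bounded_bilinear.continuous_on[OF assms(1)])
next
  case (Suc k)
  show ?case
  proof (rule ck_on_SucI[OF assms(2) bounded_bilinear.FDERIV[OF assms(1)
          ck_on_Suc_has_derivative[OF Suc.prems(1)] ck_on_Suc_has_derivative[OF Suc.prems(2)]]])
    show "ck_on k S (\<lambda>x. B (f x) (frechet_derivative g (at x) v) + B (frechet_derivative f (at x) v) (g x))" for v
      by (intro ck_on_add[OF assms(2)] Suc.IH)
        (use Suc.prems Suc.prems[THEN ck_on_SucD] in auto)
  qed
qed

lemmas ck_on_scaleR = ck_on_bounded_bilinear[OF bounded_bilinear_scaleR]
lemmas ck_on_inner = ck_on_bounded_bilinear[OF bounded_bilinear_inner]

lemma ck_on_bounded_linear_compose: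
  assumes "bounded_linear L" "open S" "ck_on k S f"
  shows "ck_on k S (\<lambda>x. L (f x))"
  using assms(3)
proof (induction k arbitrary: f)
  case 0
  then show ?case using assms(1) by (auto intro: bounded_linear.continuous_on)
next
  case (Suc k)
  show ?case
    by (rule ck_on_SucI[OF assms(2) bounded_linear.has_derivative
          [OF assms(1) ck_on_Suc_has_derivative[OF Suc.prems]]])
      (use Suc in auto)
qed

lemma linear_eq_sum_Basis:
  fixes L :: "'a::euclidean_space \<Rightarrow> 'b::real_vector"
  assumes "linear L" shows "L v = (\<Sum>b\<in>Basis. (v \<bullet> b) *\<^sub>R L b)"
  by (metis (mono_tags, lifting) assms euclidean_representation linear_sum linear_cmul sum.cong)

text \<open>
  Expanding the inner derivative in the basis presents the chain rule as a sum of products, each with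
  the lower order factor \<open>Df \<circ> g\<close> applied to a fixed vector, so the induction over \<open>k\<close> stays with
  one outer domain and one inner map.
\<close>

lemma ck_on_compose:
  assumes "open S" "ck_on k T f" "ck_on k S g" "g ` S \<subseteq> T"
  shows "ck_on k S (\<lambda>x. f (g x))"
  using assms(2-)
proof (induction k arbitrary: f)
  case 0
  then show ?case by (auto intro: continuous_on_compose2)
next
  case (Suc k)
  let ?Df = "\<lambda>x. frechet_derivative f (at (g x))" and ?Dg = "\<lambda>x. frechet_derivative g (at x)"
  have df: "(f has_derivative ?Df x) (at (g x))" if "x \<in> S" for x
    using ck_on_Suc_has_derivative[OF Suc.prems(1)] Suc.prems(3) that by blast
  show ?case
  proof (rule ck_on_SucI[OF assms(1)])
    show "((\<lambda>x. f (g x)) has_derivative (\<lambda>v. ?Df x (?Dg x v))) (at x)" if "x \<in> S" for x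
      using has_derivative_compose[OF ck_on_Suc_has_derivative[OF Suc.prems(2) that] df[OF that]] .
    show "ck_on k S (\<lambda>x. ?Df x (?Dg x v))" for v
    proof (rule ck_on_cong[OF assms(1)])
      show "(\<Sum>b\<in>Basis. (?Dg x v \<bullet> b) *\<^sub>R ?Df x b) = ?Df x (?Dg x v)" if "x \<in> S" for x
        using linear_eq_sum_Basis[OF has_derivative_linear[OF df[OF that]]] by metis
      show "ck_on k S (\<lambda>x. \<Sum>b\<in>Basis. (?Dg x v \<bullet> b) *\<^sub>R ?Df x b)"
        by (intro ck_on_sum ck_on_scaleR ck_on_inner ck_on_const Suc.IH assms(1))
          (use Suc.prems ck_on_SucD[OF Suc.prems(2)] in auto)
    qed
  qed
qed

section \<open>The inverse of a smooth family of invertible operators\<close>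

lemma isCont_iff_tendsto_nhds: "isCont f x \<longleftrightarrow> (f \<longlongrightarrow> f x) (nhds x)"
  unfolding isCont_def by (rule tendsto_at_iff_tendsto_nhds)

text \<open>
  Injectivity of a linear map is stable under small perturbations, uniformly in the vector. This keeps
  the inverses of a continuous family bounded near a point.
\<close>

lemma linear_family_lower_bound:
  fixes A :: "'x::t2_space \<Rightarrow> 'a::euclidean_space \<Rightarrow> 'a"
  assumes "open S" "y0 \<in> S" and lin: "\<And>y. y \<in> S \<Longrightarrow> linear (A y)" and "inj (A y0)"
    and cont: "\<And>v. continuous_on S (\<lambda>y. A y v)"
  obtains c where "c > 0" "\<forall>\<^sub>F y in nhds y0. \<forall>w. c * norm w \<le> norm (A y w)"
proof -
  obtain c where c: "c > 0" "\<And>w. c * norm w \<le> norm (A y0 w)"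
    using linear_inj_bounded_below_pos[OF lin[OF assms(2)] assms(4)] by blast
  define e where "e = (\<lambda>y. \<Sum>b\<in>Basis. norm (A y b - A y0 b))"
  have "isCont (\<lambda>y. A y b) y0" for b
    using cont assms(1,2) continuous_on_eq_continuous_at by blast
  then have "isCont e y0" unfolding e_def by (intro continuous_intros)
  then have "(e \<longlongrightarrow> e y0) (nhds y0)" by (simp add: isCont_iff_tendsto_nhds)
  then have "(e \<longlongrightarrow> 0) (nhds y0)" by (simp add: e_def)
  then have "\<forall>\<^sub>F y in nhds y0. e y < c / 2" using c(1) by (intro order_tendstoD(2)) auto
  moreover have "\<forall>\<^sub>F y in nhds y0. y \<in> S" using assms(1,2) by (rule eventually_nhds_in_open)
  ultimately have "\<forall>\<^sub>F y in nhds y0. \<forall>w. c / 2 * norm w \<le> norm (A y w)"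
  proof eventually_elim
    case (elim y)
    show ?case
    proof
      fix w
      have "A y w - A y0 w = (\<Sum>b\<in>Basis. (w \<bullet> b) *\<^sub>R (A y b - A y0 b))"
        using linear_eq_sum_Basis[OF lin[OF elim(2)], of w] linear_eq_sum_Basis[OF lin[OF assms(2)], of w]
        by (simp add: scaleR_diff_right sum_subtractf)
      also have "norm \<dots> \<le> (\<Sum>b\<in>Basis. norm w * norm (A y b - A y0 b))"
        by (rule sum_norm_le) (auto intro: mult_right_mono simp: Basis_le_norm)
      also have "\<dots> = norm w * e y" by (simp add: e_def sum_distrib_left)
      also have "\<dots> \<le> norm w * (c / 2)" using elim(1) by (intro mult_left_mono) auto
      finally show "c / 2 * norm w \<le> norm (A y w)"
        using c(2)[of w] norm_triangle_sub[of "A y0 w" "A y w"]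
        by (simp add: norm_minus_commute algebra_simps)
    qed
  qed
  then show thesis using that[of "c / 2"] c(1) by simp
qed

text \<open>
  With \<open>w y = inv (A y) v\<close>, the vector \<open>A y (w y - w y0) = v - A y (w y0)\<close> tends to \<open>0\<close>, and the
  lower bound transfers this to \<open>w y - w y0\<close>.
\<close>

lemma continuous_on_inv_linear_family:
  fixes A :: "'x::t2_space \<Rightarrow> 'a::euclidean_space \<Rightarrow> 'a"
  assumes "open S" and lin: "\<And>y. y \<in> S \<Longrightarrow> linear (A y)" and bij: "\<And>y. y \<in> S \<Longrightarrow> bij (A y)"
    and cont: "\<And>v. continuous_on S (\<lambda>y. A y v)"
  shows "continuous_on S (\<lambda>y. inv (A y) v)"
proof -
  have "isCont (\<lambda>y. inv (A y) v) y0" if "y0 \<in> S" for y0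
  proof -
    let ?w = "\<lambda>y. inv (A y) v"
    obtain c where c: "c > 0" "\<forall>\<^sub>F y in nhds y0. \<forall>w. c * norm w \<le> norm (A y w)"
      using linear_family_lower_bound[OF assms(1) \<open>y0 \<in> S\<close> lin bij_is_inj[OF bij[OF \<open>y0 \<in> S\<close>]] cont] by blast
    have Aw: "A y (?w y) = v" if "y \<in> S" for y
      using bij[OF that] by (simp add: bij_is_surj surj_f_inv_f)
    have "\<forall>\<^sub>F y in nhds y0. y \<in> S" using assms(1) \<open>y0 \<in> S\<close> by (rule eventually_nhds_in_open)
    then have "\<forall>\<^sub>F y in nhds y0. norm (?w y - ?w y0) \<le> norm (v - A y (?w y0)) * (1 / c)"
      using c(2)
    proof eventually_elim
      case (elim y)
      have "c * norm (?w y - ?w y0) \<le> norm (A y (?w y - ?w y0))" using elim(2) by blast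
      also have "A y (?w y - ?w y0) = v - A y (?w y0)"
        using Aw[OF elim(1)] lin[OF elim(1)] by (simp add: linear_diff)
      finally show ?case using c(1) by (simp add: field_simps)
    qed
    moreover have "((\<lambda>y. norm (v - A y (?w y0)) * (1 / c)) \<longlongrightarrow> 0) (nhds y0)"
    proof -
      have "isCont (\<lambda>y. A y (?w y0)) y0"
        using cont assms(1) \<open>y0 \<in> S\<close> continuous_on_eq_continuous_at by blast
      then have "isCont (\<lambda>y. norm (v - A y (?w y0)) * (1 / c)) y0" by (intro continuous_intros)
      then have "((\<lambda>y. norm (v - A y (?w y0)) * (1 / c)) \<longlongrightarrow> norm (v - A y0 (?w y0)) * (1 / c)) (nhds y0)"
        unfolding isCont_iff_tendsto_nhds .
      then show ?thesis using Aw[OF \<open>y0 \<in> S\<close>] by simp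
    qed
    ultimately have "((\<lambda>y. ?w y - ?w y0) \<longlongrightarrow> 0) (nhds y0)" by (rule Lim_null_comparison)
    then have "(?w \<longlongrightarrow> ?w y0) (nhds y0)" using LIM_zero_iff by blast
    then show ?thesis by (simp add: isCont_iff_tendsto_nhds)
  qed
  then show ?thesis by (simp add: continuous_at_imp_continuous_on)
qed

text \<open>
  At a zero of the second factor the product rule asks only for continuity of the first factor. This
  serves to differentiate inverse operators, where the first factor is the inverse itself, known at that
  stage only to be continuous.
\<close>

lemma has_derivative_scaleR_vanishing:
  fixes c :: "'a::real_normed_vector \<Rightarrow> real"
  assumes "isCont c x" "(f has_derivative f') (at x)" "f x = 0"
  shows "((\<lambda>y. c y *\<^sub>R f y) has_derivative (\<lambda>v. c x *\<^sub>R f' v)) (at x)"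
proof -
  interpret f': bounded_linear f' using assms(2) by (rule has_derivative_bounded_linear)
  let ?q = "\<lambda>y. inverse (norm (y - x)) *\<^sub>R (f y - f' (y - x))"
  have q: "(?q \<longlongrightarrow> 0) (at x)"
    using assms(2,3) by (simp add: has_derivative_at_within divide_inverse)
  obtain K where K: "K > 0" "\<And>v. norm (f' v) \<le> norm v * K" using f'.pos_bounded by blast
  have lim: "((\<lambda>y. c y *\<^sub>R ?q y + (c y - c x) *\<^sub>R (f' (y - x) /\<^sub>R norm (y - x))) \<longlongrightarrow> 0) (at x)"
  proof (rule tendsto_add_zero)
    show "((\<lambda>y. c y *\<^sub>R ?q y) \<longlongrightarrow> 0) (at x)"
      using tendsto_scaleR[OF assms(1)[unfolded isCont_def] q] by simp
    show "((\<lambda>y. (c y - c x) *\<^sub>R (f' (y - x) /\<^sub>R norm (y - x))) \<longlongrightarrow> 0) (at x)"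
    proof (rule Lim_null_comparison)
      show "\<forall>\<^sub>F y in at x. norm ((c y - c x) *\<^sub>R (f' (y - x) /\<^sub>R norm (y - x))) \<le> \<bar>c y - c x\<bar> * K"
      proof (rule always_eventually, rule allI)
        fix y
        have "norm (f' (y - x) /\<^sub>R norm (y - x)) \<le> K"
          using K(2)[of "y - x"] K(1) by (cases "y = x") (auto simp: field_simps)
        then show "norm ((c y - c x) *\<^sub>R (f' (y - x) /\<^sub>R norm (y - x))) \<le> \<bar>c y - c x\<bar> * K"
          by (simp only: norm_scaleR) (intro mult_left_mono, auto)
      qed
      have "isCont (\<lambda>y. \<bar>c y - c x\<bar> * K) x" using assms(1) by (intro continuous_intros)
      then show "((\<lambda>y. \<bar>c y - c x\<bar> * K) \<longlongrightarrow> 0) (at x)" by (simp add: isCont_def)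
    qed
  qed
  have regroup: "c y *\<^sub>R (r *\<^sub>R (F - G)) + (c y - c x) *\<^sub>R (r *\<^sub>R G) = r *\<^sub>R (c y *\<^sub>R F - c x *\<^sub>R G)"
    for y r and F G :: 'b
    by (simp add: algebra_simps)
  from lim have "((\<lambda>y. (c y *\<^sub>R f y - c x *\<^sub>R f x - c x *\<^sub>R f' (y - x)) /\<^sub>R norm (y - x)) \<longlongrightarrow> 0) (at x)"
    by (rule Lim_transform_eventually) (simp only: assms(3) scaleR_zero_right diff_zero regroup eventually_True simp_thms)
  then show ?thesis
    unfolding has_derivative_at_within
    by (auto intro: bounded_linear_intros f'.bounded_linear_axioms)
qed

text \<open>
  The familiar \<open>- inv A \<circ> A' \<circ> inv A\<close>. It comes from the exact identity
  \<open>w y = w y0 - inv (A y0) ((A y - A y0) (w y))\<close>, expanded in the basis so that the coordinates of the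
  merely continuous \<open>w y\<close> multiply functions of \<open>y\<close> that vanish at \<open>y0\<close>.
\<close>

lemma has_derivative_inv_linear_family:
  fixes A :: "'x::real_normed_vector \<Rightarrow> 'a::euclidean_space \<Rightarrow> 'a"
  assumes "open S" "y0 \<in> S"
    and lin: "\<And>y. y \<in> S \<Longrightarrow> linear (A y)" and bij: "\<And>y. y \<in> S \<Longrightarrow> bij (A y)"
    and cont: "\<And>v. continuous_on S (\<lambda>y. A y v)"
    and deriv: "\<And>v. ((\<lambda>y. A y v) has_derivative A' v) (at y0)"
  shows "((\<lambda>y. inv (A y) v) has_derivative
           (\<lambda>h. - (\<Sum>b\<in>Basis. (inv (A y0) v \<bullet> b) *\<^sub>R inv (A y0) (A' b h)))) (at y0)"
proof -
  let ?w = "\<lambda>y. inv (A y) v" and ?A0 = "inv (A y0)"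
  have linA0: "linear ?A0"
    using lin[OF assms(2)] bij[OF assms(2)] by (simp add: bij_is_inj bij_is_surj linear_injective_isomorphism inj_linear_imp_inv_linear)
  have w: "A y (?w y) = v" if "y \<in> S" for y
    using bij[OF that] by (simp add: bij_is_surj surj_f_inv_f)
  have expand: "?w y0 - (\<Sum>b\<in>Basis. (?w y \<bullet> b) *\<^sub>R ?A0 (A y b - A y0 b)) = ?w y" if "y \<in> S" for y
  proof -
    have "(\<Sum>b\<in>Basis. (?w y \<bullet> b) *\<^sub>R ?A0 (A y b - A y0 b))
        = ?A0 (\<Sum>b\<in>Basis. (?w y \<bullet> b) *\<^sub>R (A y b - A y0 b))"
      by (simp add: linear_sum[OF linA0] linear_cmul[OF linA0])
    also have "(\<Sum>b\<in>Basis. (?w y \<bullet> b) *\<^sub>R (A y b - A y0 b)) = A y (?w y) - A y0 (?w y)"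
      using linear_eq_sum_Basis[OF lin[OF that], of "?w y"] linear_eq_sum_Basis[OF lin[OF assms(2)], of "?w y"]
      by (simp add: scaleR_diff_right sum_subtractf)
    also have "?A0 \<dots> = ?w y0 - ?w y"
      using w[OF that] bij[OF assms(2)] by (simp add: linear_diff[OF linA0] bij_is_inj)
    finally show ?thesis by simp
  qed
  have contw: "isCont ?w y0"
    using continuous_on_inv_linear_family[OF assms(1) lin bij cont] assms(1,2)
    by (simp add: continuous_on_eq_continuous_at)
  have "((\<lambda>y. ?w y0 - (\<Sum>b\<in>Basis. (?w y \<bullet> b) *\<^sub>R ?A0 (A y b - A y0 b))) has_derivative
      (\<lambda>h. 0 - (\<Sum>b\<in>Basis. (?w y0 \<bullet> b) *\<^sub>R ?A0 (A' b h)))) (at y0)"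
  proof (intro has_derivative_diff has_derivative_const has_derivative_sum has_derivative_scaleR_vanishing)
    fix b :: 'a
    show "isCont (\<lambda>y. ?w y \<bullet> b) y0" using contw by (intro continuous_intros)
    have "((\<lambda>y. A y b - A y0 b) has_derivative (\<lambda>h. A' b h - 0)) (at y0)"
      by (intro has_derivative_diff has_derivative_const deriv)
    then show "((\<lambda>y. ?A0 (A y b - A y0 b)) has_derivative (\<lambda>h. ?A0 (A' b h))) (at y0)"
      using bounded_linear.has_derivative linA0 linear_conv_bounded_linear by fastforce
    show "?A0 (A y0 b - A y0 b) = 0" by (simp add: linear_0[OF linA0])
  qed
  then show ?thesis
    using has_derivative_transform_within_open[OF _ assms(1,2) expand] by simp
qed

text \<open>
  The derivative of the inverse is a polynomial in the inverse and in the derivative of the family, so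
  the order of differentiability can be raised one step at a time.
\<close>

lemma ck_on_inv_linear_family:
  fixes A :: "'x::euclidean_space \<Rightarrow> 'a::euclidean_space \<Rightarrow> 'a"
  assumes "open S" and lin: "\<And>y. y \<in> S \<Longrightarrow> linear (A y)" and bij: "\<And>y. y \<in> S \<Longrightarrow> bij (A y)"
    and "\<And>v. ck_on k S (\<lambda>y. A y v)"
  shows "ck_on k S (\<lambda>y. inv (A y) v)"
  using assms(4)
proof (induction k arbitrary: v)
  case 0
  then show ?case using continuous_on_inv_linear_family[OF assms(1) lin bij] by simp
next
  case (Suc k)
  let ?w = "\<lambda>y. inv (A y) v" and ?A' = "\<lambda>y b. frechet_derivative (\<lambda>y. A y b) (at y)"
  have IH: "ck_on k S (\<lambda>y. inv (A y) v)" for v using Suc.IH Suc.prems ck_on_SucD by blast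
  show ?case
  proof (rule ck_on_SucI[OF assms(1)])
    show "(?w has_derivative
        (\<lambda>h. - (\<Sum>b\<in>Basis. (?w y \<bullet> b) *\<^sub>R inv (A y) (?A' y b h)))) (at y)" if "y \<in> S" for y
      by (rule has_derivative_inv_linear_family[OF assms(1) that lin bij])
        (use ck_on_imp_continuous_on[OF Suc.prems] ck_on_Suc_has_derivative[OF Suc.prems that] in auto)
    show "ck_on k S (\<lambda>y. - (\<Sum>b\<in>Basis. (?w y \<bullet> b) *\<^sub>R inv (A y) (?A' y b h)))" for h
    proof (rule ck_on_cong[OF assms(1)])
      show "(\<Sum>b\<in>Basis. \<Sum>b'\<in>Basis. (- (?w y \<bullet> b) *\<^sub>R (?A' y b h \<bullet> b')) *\<^sub>R inv (A y) b')
          = - (\<Sum>b\<in>Basis. (?w y \<bullet> b) *\<^sub>R inv (A y) (?A' y b h))" if "y \<in> S" for y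
      proof -
        have "linear (inv (A y))"
          using lin[OF that] bij[OF that] by (simp add: bij_is_inj bij_is_surj inj_linear_imp_inv_linear)
        from linear_eq_sum_Basis[OF this] have "inv (A y) z = (\<Sum>b'\<in>Basis. (z \<bullet> b') *\<^sub>R inv (A y) b')" for z .
        from this[of "?A' y _ h"] show ?thesis
          by (simp add: scaleR_sum_right sum_negf)
      qed
      show "ck_on k S (\<lambda>y. \<Sum>b\<in>Basis. \<Sum>b'\<in>Basis.
          (- (?w y \<bullet> b) *\<^sub>R (?A' y b h \<bullet> b')) *\<^sub>R inv (A y) b')"
        by (intro ck_on_sum ck_on_scaleR ck_on_inner IH ck_on_const
            ck_on_bounded_linear_compose[OF bounded_linear_minus[OF bounded_linear_ident]] assms(1))
          (use Suc.prems in auto)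
    qed
  qed
qed

section \<open>The smooth inverse function theorem\<close>

text \<open>
  The topological part and the first derivative come from \<open>inverse_function_theorem\<close>. Higher orders
  are a bootstrap: \<open>Dg = inv (Dh \<circ> g)\<close> is as often differentiable as \<open>g\<close> itself.
\<close>

theorem smooth_inverse_function_theorem:
  fixes h :: "'a::euclidean_space \<Rightarrow> 'a"
  assumes "open W" "p \<in> W" "smooth_on W h" "inj (frechet_derivative h (at p))"
  obtains U V g where "p \<in> U" "U \<subseteq> W" "diffeomorphism U V h g"
proof -
  let ?D = "\<lambda>x. frechet_derivative h (at x)"
  have ck: "ck_on k W h" for k using assms(3) by (simp add: smooth_on_def)
  have deriv: "(h has_derivative ?D x) (at x)" if "x \<in> W" for x
    using ck_on_Suc_has_derivative[OF ck that] .
  have ckD: "ck_on k W (\<lambda>x. ?D x v)" for k v using ck[of "Suc k"] by simp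
  have app: "blinfun_apply (Blinfun (?D x)) = ?D x" if "x \<in> W" for x
    using deriv[OF that] by (simp add: bounded_linear_Blinfun_apply has_derivative_bounded_linear)
  have cont: "continuous_on W (\<lambda>x. Blinfun (?D x))"
  proof (rule continuous_on_blinfun_componentwise)
    fix i :: 'a
    have "continuous_on W (\<lambda>x. ?D x i)" using ckD[of 0] by simp
    then show "continuous_on W (\<lambda>x. blinfun_apply (Blinfun (?D x)) i)"
      by (rule continuous_on_eq) (simp add: app)
  qed
  obtain L where L: "linear L" "L \<circ> ?D p = id"
    using linear_injective_left_inverse[OF has_derivative_linear[OF deriv[OF assms(2)]] assms(4)] by blast
  have "Blinfun L o\<^sub>L Blinfun (?D p) = id_blinfun"
    by (rule blinfun_eqI)
      (use L app[OF assms(2)] in \<open>auto simp: bounded_linear_Blinfun_apply linear_conv_bounded_linear fun_eq_iff\<close>)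
  from inverse_function_theorem[OF assms(1) _ cont assms(2) this, of h]
  obtain U V g g' where UV: "open U" "U \<subseteq> W" "p \<in> U" "open V" "homeomorphism U V h g"
    and g': "\<And>y. y \<in> V \<Longrightarrow> (g has_derivative g' y) (at y)"
      "\<And>y. y \<in> V \<Longrightarrow> g' y = inv (blinfun_apply (Blinfun (?D (g y))))"
      "\<And>y. y \<in> V \<Longrightarrow> bij (blinfun_apply (Blinfun (?D (g y))))"
    using deriv app by (metis (no_types, lifting))
  have gW: "g y \<in> W" if "y \<in> V" for y
    using UV(2,5) that by (auto simp: homeomorphism_def)
  have "ck_on k V g" for k
  proof (induction k)
    case 0
    then show ?case using UV(5) by (simp add: homeomorphism_def)
  next
    case (Suc k)
    show ?case
    proof (rule ck_on_SucI[OF UV(4)])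
      show "(g has_derivative inv (?D (g y))) (at y)" if "y \<in> V" for y
        using g'(1,2)[OF that] app[OF gW[OF that]] by simp
      show "ck_on k V (\<lambda>y. inv (?D (g y)) v)" for v
      proof (rule ck_on_inv_linear_family[OF UV(4)])
        show "linear (?D (g y))" if "y \<in> V" for y using deriv[OF gW[OF that]] by (rule has_derivative_linear)
        show "bij (?D (g y))" if "y \<in> V" for y using g'(3)[OF that] app[OF gW[OF that]] by simp
        show "ck_on k V (\<lambda>y. ?D (g y) v)" for v
          by (rule ck_on_compose[OF UV(4) ckD Suc]) (use gW in auto)
      qed
    qed
  qed
  moreover have "smooth_on U h" using ck_on_subset[OF ck UV(2)] by (simp add: smooth_on_def)
  ultimately have "diffeomorphism U V h g" using UV by (simp add: diffeomorphism_def smooth_on_def)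
  then show thesis using that UV by blast
qed

section \<open>Regular zero sets\<close>

text \<open>
  The chart at \<open>p\<close> maps the ambient space to itself. Let \<open>g i\<close> be the gradient of \<open>f i\<close> at
  \<open>p\<close> and \<open>L\<close> the orthogonal complement of all gradients. The chart sends \<open>q\<close> to
  \<open>\<Sum>i. f i q *\<^sub>R g i\<close> plus a linear image of \<open>q\<close> in \<open>L\<close>; the values \<open>f i q\<close> can be read off from the
  component in the span of the gradients, so the zero set becomes \<open>L\<close>.
\<close>

theorem smooth_submanifold_regular_zero_set:
  fixes f :: "'i \<Rightarrow> 'a::euclidean_space \<Rightarrow> real"
  assumes "finite I" "open W" and smooth: "\<And>i. i \<in> I \<Longrightarrow> smooth_on W (f i)"
    and regular: "\<And>p c i. \<lbrakk>p \<in> W; \<And>j. j \<in> I \<Longrightarrow> f j p = 0;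
        \<And>v. (\<Sum>j\<in>I. c j * frechet_derivative (f j) (at p) v) = 0; i \<in> I\<rbrakk> \<Longrightarrow> c i = 0"
  shows "smooth_submanifold {q \<in> W. \<forall>i\<in>I. f i q = 0} (int DIM('a) - int (card I))"
  unfolding smooth_submanifold_def
proof
  let ?M = "{q \<in> W. \<forall>i\<in>I. f i q = 0}"
  fix p assume p: "p \<in> ?M"
  let ?D = "\<lambda>i. frechet_derivative (f i) (at p)"
  have ck: "ck_on k W (f i)" if "i \<in> I" for k i using smooth[OF that] by (simp add: smooth_on_def)
  have deriv: "(f i has_derivative ?D i) (at p)" if "i \<in> I" for i
    using ck_on_Suc_has_derivative[OF ck[OF that]] p by blast
  define g where "g = (\<lambda>i. \<Sum>b\<in>Basis. ?D i b *\<^sub>R b)"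
  have D: "?D i v = g i \<bullet> v" if "i \<in> I" for i v
    using linear_eq_sum_Basis[OF has_derivative_linear[OF deriv[OF that]], of v]
    by (simp add: g_def inner_sum_left inner_commute[of v] mult.commute)
  have indep: "c i = 0" if "(\<Sum>j\<in>I. c j *\<^sub>R g j) = 0" "i \<in> I" for c i
  proof (rule regular[OF _ _ _ that(2)])
    fix v
    have "(\<Sum>j\<in>I. c j * ?D j v) = (\<Sum>j\<in>I. c j *\<^sub>R g j) \<bullet> v" by (simp add: inner_sum_left D)
    then show "(\<Sum>j\<in>I. c j * ?D j v) = 0" using that(1) by simp
  qed (use p in auto)
  have inj: "inj_on g I"
  proof (rule inj_onI, rule ccontr)
    fix i j assume ij: "i \<in> I" "j \<in> I" "g i = g j" "i \<noteq> j"
    have "(\<Sum>k\<in>I. (of_bool (k = i) - of_bool (k = j)) *\<^sub>R g k) = 0"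
      using ij assms(1) by (simp add: scaleR_diff_left sum_subtractf of_bool_def if_distrib[of "\<lambda>r. r *\<^sub>R _"] sum.delta cong: if_cong)
    from indep[OF this ij(1)] ij(4) show False by simp
  qed
  have "independent (g ` I)"
    unfolding dependent_finite[OF finite_imageI[OF assms(1)]]
    by (auto simp: sum.reindex[OF inj] dest: indep)
  then have dimG: "dim (span (g ` I)) = card I"
    by (simp add: dim_eq_card_independent card_image[OF inj])
  define L where "L = {y. \<forall>x\<in>span (g ` I). orthogonal x y}"
  have "dim L + dim (span (g ` I)) = DIM('a)"
    using dim_subspace_orthogonal_to_vectors[of "span (g ` I)" UNIV] by (simp add: L_def)
  then have dimL: "int (dim L) = int DIM('a) - int (card I)" using dimG by linarith
  have subL: "subspace L"
    by (auto simp: L_def subspace_def orthogonal_def inner_right_distrib)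
  have LI: "v \<in> L" if "\<And>i. i \<in> I \<Longrightarrow> g i \<bullet> v = 0" for v
  proof -
    have "subspace {x. x \<bullet> v = 0}" by (auto simp: subspace_def inner_left_distrib)
    then have "span (g ` I) \<subseteq> {x. x \<bullet> v = 0}" using that by (intro span_minimal) auto
    then show ?thesis by (auto simp: L_def orthogonal_def)
  qed
  obtain B where B: "B \<subseteq> L" "finite B" "L = span B"
    using basis_subspace_exists[OF subL] by metis
  \<comment> \<open>As \<open>B\<close> spans \<open>L\<close>, the second sum is a self-adjoint operator with range in \<open>L\<close> and positive
    definite there; it takes the place of the orthogonal projection.\<close>
  define h where "h = (\<lambda>q. (\<Sum>i\<in>I. f i q *\<^sub>R g i) + (\<Sum>b\<in>B. (q \<bullet> b) *\<^sub>R b))"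
  have projL: "(\<Sum>b\<in>B. (q \<bullet> b) *\<^sub>R b) \<in> L" for q
    using B(1) by (intro subspace_sum[OF subL] subspace_scale[OF subL]) auto
  have hL: "h q \<in> L \<longleftrightarrow> (\<forall>i\<in>I. f i q = 0)" for q
  proof
    let ?s = "\<Sum>i\<in>I. f i q *\<^sub>R g i"
    assume "h q \<in> L"
    then have "?s \<in> L" using subspace_diff[OF subL _ projL[of q]] by (fastforce simp: h_def)
    moreover have "?s \<in> span (g ` I)" by (intro span_sum span_scale span_base) auto
    ultimately have "?s = 0" by (auto simp: L_def orthogonal_def)
    then show "\<forall>i\<in>I. f i q = 0" using indep[of "\<lambda>i. f i q"] by blast
  next
    assume "\<forall>i\<in>I. f i q = 0"
    then show "h q \<in> L" using projL by (simp add: h_def)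
  qed
  have "smooth_on W h"
    unfolding smooth_on_def h_def
    by (intro allI ck_on_add ck_on_sum ck_on_scaleR ck_on_inner ck_on_const ck
        ck_on_bounded_linear[OF _ bounded_linear_ident] assms(2))
  moreover have "inj (frechet_derivative h (at p))"
  proof -
    let ?Dh = "\<lambda>v. (\<Sum>i\<in>I. ?D i v *\<^sub>R g i) + (\<Sum>b\<in>B. (v \<bullet> b) *\<^sub>R b)"
    have Dh: "(h has_derivative ?Dh) (at p)"
      unfolding h_def by (auto intro!: derivative_eq_intros deriv)
    have "v = 0" if "?Dh v = 0" for v
    proof -
      have "(\<Sum>i\<in>I. (g i \<bullet> v)\<^sup>2) + (\<Sum>b\<in>B. (b \<bullet> v)\<^sup>2) = ?Dh v \<bullet> v"
        by (simp add: inner_add_left inner_sum_left D power2_eq_square inner_commute[of v])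
      also have "\<dots> = 0" by (simp add: that)
      finally have "(\<Sum>i\<in>I. (g i \<bullet> v)\<^sup>2) = 0" "(\<Sum>b\<in>B. (b \<bullet> v)\<^sup>2) = 0"
        by (simp_all add: add_nonneg_eq_0_iff sum_nonneg)
      then have v: "\<And>i. i \<in> I \<Longrightarrow> g i \<bullet> v = 0" "\<And>b. b \<in> B \<Longrightarrow> b \<bullet> v = 0"
        using assms(1) B(2) by (auto simp: sum_nonneg_eq_0_iff)
      have "subspace {x. x \<bullet> v = 0}" by (auto simp: subspace_def inner_left_distrib)
      then have "span B \<subseteq> {x. x \<bullet> v = 0}" using v(2) by (intro span_minimal) auto
      then show "v = 0" using LI[OF v(1)] B(3) by auto
    qed
    then have "inj ?Dh" using linear_injective_0[OF has_derivative_linear[OF Dh]] by blast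
    then show ?thesis using frechet_derivative_at[OF Dh] by simp
  qed
  ultimately obtain U V k where UV: "p \<in> U" "U \<subseteq> W" "diffeomorphism U V h k"
    using smooth_inverse_function_theorem[OF assms(2)] p by blast
  have "h ` U = V" using UV(3) by (simp add: diffeomorphism_def homeomorphism_def)
  moreover have "?M \<inter> U = {q \<in> U. h q \<in> L}" using UV(2) by (auto simp: hL)
  ultimately have "h ` (?M \<inter> U) = L \<inter> V" by auto
  with UV(1,3) subL dimL have "p \<in> U \<and> diffeomorphism U V h k \<and> subspace L \<and>
      int (dim L) = int DIM('a) - int (card I) \<and> h ` (?M \<inter> U) = L \<inter> V" by simp
  then show "\<exists>U (V :: 'a set) h g L. p \<in> U \<and> diffeomorphism U V h g \<and> subspace L \<and>
      int (dim L) = int DIM('a) - int (card I) \<and> h ` (?M \<inter> U) = L \<inter> V"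
    by (intro exI)
qed

section \<open>Moduli spaces as spaces of normalised configurations\<close>

lemma bij_betw_vertex: "bij_betw vertex {..<CARD('v)} (UNIV :: 'v::{finite,linorder} set)"
proof -
  have "vertex ` {..<CARD('v)} = set (sorted_list_of_set (UNIV :: 'v set))"
    by (auto simp: vertex_def set_conv_nth image_def)
  then show ?thesis
    by (simp add: bij_betw_def inj_on_def vertex_def nth_eq_iff_index_eq)
qed

lemma vertex_eq_iff:
  assumes "i < CARD('v::{finite,linorder})" "j < CARD('v)"
  shows "(vertex i :: 'v) = vertex j \<longleftrightarrow> i = j"
  using bij_betw_vertex[where 'v = 'v] assms by (auto simp: bij_betw_def inj_on_eq_iff)

definition first_edge :: "('u::{finite,linorder}, 'v::finite, 'w::finite) triple \<Rightarrow> real^2" where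
  "first_edge p = fst p $ vertex 1 - fst p $ vertex 0"

lemma first_edge_on_positive_x_axis_iff:
  "first_edge_on_positive_x_axis p \<longleftrightarrow> first_edge p $ 1 > 0 \<and> first_edge p $ 2 = 0"
  by (cases p) (simp add: first_edge_on_positive_x_axis_def first_edge_def Let_def)

text \<open>
  The rotation that takes the direction of \<open>e\<close> to that of the positive axis.
\<close>

definition align :: "real^2 \<Rightarrow> real^2^2" where
  "align e = (\<chi> i j. (if i = j then e $ 1 else if i = 1 then e $ 2 else - e $ 2) / norm e)"

lemma norm_square_2: "(norm (e :: real^2))\<^sup>2 = (e $ 1)\<^sup>2 + (e $ 2)\<^sup>2"
  by (simp add: norm_vec_def L2_set_def sum_2)

lemma rotation_matrix_align:
  assumes "e \<noteq> 0" shows "rotation_matrix (align e)"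
proof -
  have n: "((e $ 1)\<^sup>2 + (e $ 2)\<^sup>2) / (norm e)\<^sup>2 = 1"
    using assms by (simp flip: norm_square_2)
  then have "det (align e) = 1"
    by (simp add: det_2 align_def power2_eq_square add_divide_distrib)
  moreover have "transpose (align e) ** align e = mat 1"
    using n by (simp add: vec_eq_iff forall_2 matrix_matrix_mult_def transpose_def sum_2
        mat_def align_def power2_eq_square add_divide_distrib add.commute mult.commute)
  ultimately show ?thesis by (simp add: rotation_matrix_def orthogonal_matrix)
qed

lemma align_mult_self: "(align e *v e) $ 1 = norm e" "(align e *v e) $ 2 = 0"
proof -
  have "(align e *v e) $ 1 = ((e $ 1)\<^sup>2 + (e $ 2)\<^sup>2) / norm e"
    by (simp add: matrix_vector_mult_def sum_2 align_def power2_eq_square add_divide_distrib)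
  also have "\<dots> = norm e" unfolding norm_square_2[symmetric] by (simp add: power2_eq_square)
  finally show "(align e *v e) $ 1 = norm e" .
  show "(align e *v e) $ 2 = 0"
    by (simp add: matrix_vector_mult_def sum_2 align_def)
qed

text \<open>
  \<open>SO(2)\<close> acts freely on nonzero vectors; hence an orbit contains at most one normalised configuration.
\<close>

lemma rotation_matrix_unique:
  fixes A :: "real^2^2"
  assumes A: "rotation_matrix A" and u: "u $ 1 > 0" "u $ 2 = 0"
    and Au: "(A *v u) $ 1 > 0" "(A *v u) $ 2 = 0"
  shows "A = mat 1"
proof -
  have Atr: "A ** transpose A = mat 1" and det: "det A = 1"
    using A by (auto simp: rotation_matrix_def orthogonal_matrix_def)
  have 1: "A $ 2 $ 1 = 0" "A $ 1 $ 1 > 0"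
    using u Au by (auto simp: matrix_vector_mult_def sum_2 zero_less_mult_iff)
  have 2: "A $ 1 $ 1 * A $ 2 $ 2 = 1" using det 1 by (simp add: det_2)
  have "(A ** transpose A) $ 2 $ 2 = 1" "(A ** transpose A) $ 1 $ 2 = 0" unfolding Atr by (simp_all add: mat_def)
  then have 3: "A $ 2 $ 2 * A $ 2 $ 2 = 1" "A $ 1 $ 2 * A $ 2 $ 2 = 0"
    using 1 by (simp_all add: matrix_matrix_mult_def transpose_def sum_2)
  have "A $ 2 $ 2 > 0" using 1(2) 2 by (metis zero_less_mult_pos zero_less_one)
  then have "A $ 2 $ 2 = 1" using 3(1) by (simp add: square_eq_1_iff)
  then show ?thesis using 1 2 3 by (simp add: vec_eq_iff forall_2 mat_def)
qed

lemma rotate_triple_mult: "rotate_triple A (rotate_triple B p) = rotate_triple (A ** B) p"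
  by (cases p) (simp add: rotate_triple_def vec_eq_iff matrix_vector_mul_assoc)

lemma rotate_triple_mat_1: "rotate_triple (mat 1) p = p"
  by (cases p) (simp add: rotate_triple_def)

lemma first_edge_rotate_triple: "first_edge (rotate_triple A p) = A *v first_edge p"
  by (cases p) (simp add: rotate_triple_def first_edge_def matrix_vector_mult_diff_distrib)

lemma rotation_matrix_mult:
  "rotation_matrix (A :: real^2^2) \<Longrightarrow> rotation_matrix B \<Longrightarrow> rotation_matrix (A ** B)"
  by (simp add: rotation_matrix_def orthogonal_matrix_mul det_mul)

lemma rotation_matrix_transpose: "rotation_matrix A \<Longrightarrow> rotation_matrix (transpose A)"
  by (simp add: rotation_matrix_def)

lemma rotate_triple_transpose:
  "rotation_matrix A \<Longrightarrow> rotate_triple (transpose A) (rotate_triple A p) = p"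
  by (simp add: rotate_triple_mult rotation_matrix_def orthogonal_matrix rotate_triple_mat_1)

lemma SO2_orbit_rotate_triple:
  assumes "rotation_matrix A" shows "SO2_orbit (rotate_triple A p) = SO2_orbit p"
proof
  show "SO2_orbit (rotate_triple A p) \<subseteq> SO2_orbit p"
    using rotation_matrix_mult[OF _ assms] by (auto simp: SO2_orbit_def rotate_triple_mult)
  show "SO2_orbit p \<subseteq> SO2_orbit (rotate_triple A p)"
  proof
    fix q assume "q \<in> SO2_orbit p"
    then obtain B where B: "rotation_matrix B" "q = rotate_triple B p" by (auto simp: SO2_orbit_def)
    then have "q = rotate_triple (B ** transpose A) (rotate_triple A p)"
      by (metis assms rotate_triple_mult rotate_triple_transpose)
    then show "q \<in> SO2_orbit (rotate_triple A p)"
      using B(1) assms rotation_matrix_mult rotation_matrix_transpose by (auto simp: SO2_orbit_def)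
  qed
qed

lemma normal_form_SO2_orbit:
  assumes "first_edge p \<noteq> 0"
  shows "normal_form (SO2_orbit p) = rotate_triple (align (first_edge p)) p" (is "_ = ?q")
  unfolding normal_form_def
proof (rule the_equality)
  let ?A = "align (first_edge p)"
  have A: "rotation_matrix ?A" using assms by (rule rotation_matrix_align)
  have "norm (first_edge p) > 0" using assms by simp
  then have q: "first_edge ?q $ 1 > 0" "first_edge ?q $ 2 = 0"
    using align_mult_self[of "first_edge p"] by (simp_all add: first_edge_rotate_triple)
  then show "?q \<in> SO2_orbit p \<and> first_edge_on_positive_x_axis ?q"
    using A by (auto simp: SO2_orbit_def first_edge_on_positive_x_axis_iff)
  fix r assume r: "r \<in> SO2_orbit p \<and> first_edge_on_positive_x_axis r"
  then have "r \<in> SO2_orbit ?q" using SO2_orbit_rotate_triple[OF A] by blast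
  then obtain B where B: "rotation_matrix B" "r = rotate_triple B ?q" by (auto simp: SO2_orbit_def)
  have "B = mat 1"
    using rotation_matrix_unique[OF B(1) q] r B(2)
    by (simp add: first_edge_on_positive_x_axis_iff first_edge_rotate_triple)
  then show "r = ?q" using B(2) by (simp add: rotate_triple_mat_1)
qed

lemma configuration_space_rotate_triple:
  assumes "rotation_matrix A" "p \<in> configuration_space d1 d2 d3"
  shows "rotate_triple A p \<in> configuration_space d1 d2 d3"
proof -
  have "orthogonal_transformation ((*v) A)"
    using assms(1) by (simp add: rotation_matrix_def orthogonal_transformation_matrix)
  then have "norm (A *v u) = norm u" for u by (simp add: orthogonal_transformation)
  then have "dist (A *v u) (A *v v) = dist u v" for u v
    by (simp only: dist_norm flip: matrix_vector_mult_diff_distrib)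
  then show ?thesis using assms(2)
    by (cases p) (simp add: configuration_space_def configurations_def rotate_triple_def
        initial_vertex_def terminal_vertex_def)
qed

lemma continuous_on_rotate_triple:
  fixes A :: "'x::topological_space \<Rightarrow> real^2^2" and p :: "'x \<Rightarrow> ('u::finite, 'v::finite, 'w::finite) triple"
  assumes "continuous_on S A" "continuous_on S p"
  shows "continuous_on S (\<lambda>s. rotate_triple (A s) (p s))"
  unfolding rotate_triple_def case_prod_beta matrix_vector_mult_def
  by (intro continuous_intros assms)

definition normalised_configurations ::
  "real list \<Rightarrow> real list \<Rightarrow> real list \<Rightarrow>
     ('u::{finite,linorder}, 'v::{finite,linorder}, 'w::{finite,linorder}) triple set" where
  "normalised_configurations d1 d2 d3 =
     {p \<in> configuration_space d1 d2 d3. first_edge_on_positive_x_axis p}"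

lemma norm_first_edge:
  assumes "d1 \<noteq> []" "p \<in> configuration_space d1 d2 d3"
  shows "norm (first_edge p) = hd d1"
proof -
  have "dist (fst p $ vertex 0) (fst p $ vertex (Suc 0)) = d1 ! 0"
    using assms by (force simp: configuration_space_def configurations_def)
  then show ?thesis using assms(1) by (simp add: first_edge_def dist_norm norm_minus_commute hd_conv_nth)
qed

text \<open>
  On configurations the normal form is \<open>p \<mapsto> rotate_triple (align (first_edge p)) p\<close>, which is continuous
  because the first edge never vanishes. It therefore descends to a continuous map on the quotient, with
  the orbit map, restricted to normalised configurations, as inverse.
\<close>

theorem moduli_space_normal_form:
  fixes d1 d2 d3 and X :: "('u::{finite,linorder}, 'v::{finite,linorder}, 'w::{finite,linorder}) triple set topology"
  assumes "d1 \<noteq> []" "hd d1 > 0"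
  defines "X \<equiv> moduli_space d1 d2 d3"
  shows "embedding_map X euclidean normal_form"
    and "normal_form ` topspace X = normalised_configurations d1 d2 d3"
proof -
  let ?C = "configuration_space d1 d2 d3 :: ('u, 'v, 'w) triple set"
  let ?N = "normalised_configurations d1 d2 d3 :: ('u, 'v, 'w) triple set"
  let ?\<nu> = "\<lambda>p :: ('u, 'v, 'w) triple. rotate_triple (align (first_edge p)) p"
  have e: "first_edge p \<noteq> 0" if "p \<in> ?C" for p using norm_first_edge[OF assms(1) that] assms(2) by auto
  have nf: "normal_form (SO2_orbit p) = ?\<nu> p" if "p \<in> ?C" for p
    using e[OF that] by (rule normal_form_SO2_orbit)
  have \<nu>N: "?\<nu> p \<in> ?N" if "p \<in> ?C" for p
  proof -
    have "norm (first_edge p) > 0" using e[OF that] by simp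
    then show ?thesis
      using align_mult_self[of "first_edge p"] configuration_space_rotate_triple[OF rotation_matrix_align[OF e[OF that]] that]
      by (simp add: normalised_configurations_def first_edge_on_positive_x_axis_iff first_edge_rotate_triple)
  qed
  have id: "?\<nu> p = p" if "p \<in> ?N" for p
  proof -
    have C: "p \<in> ?C" and "first_edge p $ 1 > 0" "first_edge p $ 2 = 0"
      using that by (auto simp: normalised_configurations_def first_edge_on_positive_x_axis_iff)
    moreover have "first_edge (?\<nu> p) $ 1 > 0" "first_edge (?\<nu> p) $ 2 = 0"
      using \<nu>N[OF C] by (auto simp: normalised_configurations_def first_edge_on_positive_x_axis_iff)
    ultimately have "align (first_edge p) = mat 1"
      using rotation_matrix_unique[OF rotation_matrix_align[OF e[OF C]]]
      by (simp add: first_edge_rotate_triple)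
    then show ?thesis by (simp add: rotate_triple_mat_1)
  qed
  have NC: "?N \<subseteq> ?C" by (auto simp: normalised_configurations_def)
  have nfN: "normal_form (SO2_orbit p) = p" if "p \<in> ?N" for p
    using nf[OF subsetD[OF NC that]] id[OF that] by simp
  have q: "quotient_map (top_of_set ?C) X SO2_orbit"
    unfolding X_def moduli_space_def by (rule quotient_map_quotient_topology)
  have topX: "topspace X = SO2_orbit ` ?C"
    by (simp add: X_def moduli_space_def topspace_quotient_topology)
  show img: "normal_form ` topspace X = ?N"
  proof
    show "normal_form ` topspace X \<subseteq> ?N" using nf \<nu>N by (simp add: topX image_subset_iff)
    show "?N \<subseteq> normal_form ` topspace X"
    proof
      fix p assume p: "p \<in> ?N"
      then have "p = normal_form (SO2_orbit p)" using nfN by simp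
      then show "p \<in> normal_form ` topspace X" using p NC unfolding topX by blast
    qed
  qed
  have "continuous_on ?C ?\<nu>"
  proof (rule continuous_on_rotate_triple)
    show "continuous_on ?C (\<lambda>p. align (first_edge p))"
      unfolding align_def
    proof (intro continuous_on_vec_lambda continuous_on_divide)
      show "continuous_on ?C (\<lambda>p. if i = j then first_edge p $ 1 else if i = 1 then first_edge p $ 2 else - first_edge p $ 2)"
        for i j :: 2
        by (cases "i = j"; cases "i = 1") (auto simp: first_edge_def intro!: continuous_intros)
      show "continuous_on ?C (\<lambda>p. norm (first_edge p))"
        unfolding first_edge_def by (intro continuous_intros)
    qed (use e in auto)
  qed (rule continuous_on_id)
  then have "continuous_on ?C (normal_form \<circ> SO2_orbit)"
    by (rule continuous_on_eq) (simp add: nf)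
  then have "continuous_map (top_of_set ?C) (top_of_set ?N) (normal_form \<circ> SO2_orbit)"
    using nf \<nu>N by (auto simp: continuous_map_in_subtopology)
  then have "continuous_map X (top_of_set ?N) normal_form"
    by (rule continuous_compose_quotient_map[OF q])
  moreover have "continuous_map (top_of_set ?N) X SO2_orbit"
    using continuous_map_from_subtopology[OF quotient_imp_continuous_map[OF q], of ?N] NC
    by (simp add: subtopology_subtopology inf.absorb2)
  moreover have "SO2_orbit (normal_form Q) = Q" if "Q \<in> topspace X" for Q
  proof -
    from that[unfolded topX] obtain p where "Q = SO2_orbit p" "p \<in> ?C" by (rule imageE)
    then show ?thesis using nf SO2_orbit_rotate_triple[OF rotation_matrix_align[OF e]] by simp
  qed
  ultimately have "homeomorphic_maps X (top_of_set ?N) normal_form SO2_orbit"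
    using nfN by (simp add: homeomorphic_maps_def)
  then show "embedding_map X euclidean normal_form"
    unfolding embedding_map_def img by (rule homeomorphic_maps_imp_map)
qed

section \<open>The constraints and their Lagrange multipliers\<close>

definition edge :: "nat \<Rightarrow> (real^2)^'v::{finite,linorder} \<Rightarrow> real^2" where
  "edge i x = x $ vertex (Suc i) - x $ vertex i"

lemma bounded_linear_component: "bounded_linear f \<Longrightarrow> bounded_linear (\<lambda>x. f x $ i)"
  using bounded_linear_compose[OF bounded_linear_vec_nth] .

lemma bounded_linear_edge: "bounded_linear (edge i)"
  unfolding edge_def by (intro bounded_linear_component bounded_linear_intros)

text \<open>
  Vector equations are listed by coordinates, with an index in \<open>2\<close>. The length equations include
  the first edge, so that \<open>Direction\<close> is a single equation; the sign of that edge is an open condition.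
\<close>

datatype linkage_constraint =
  LengthX nat | LengthY nat | LengthZ nat | Direction
  | StartX 2 | StartY 2 | StartZ 2 | CloseXY 2 | CloseYZ 2

definition linkage_constraints :: "nat \<Rightarrow> nat \<Rightarrow> nat \<Rightarrow> linkage_constraint set" where
  "linkage_constraints n1 n2 n3 =
     LengthX ` {..<n1} \<union> LengthY ` {..<n2} \<union> LengthZ ` {..<n3} \<union> {Direction}
     \<union> range StartX \<union> range StartY \<union> range StartZ \<union> range CloseXY \<union> range CloseYZ"

lemma finite_linkage_constraints: "finite (linkage_constraints n1 n2 n3)"
  by (simp add: linkage_constraints_def)

lemma sum_linkage_constraints:
  "(\<Sum>j\<in>linkage_constraints n1 n2 n3. F j) =
     (\<Sum>i<n1. F (LengthX i)) + (\<Sum>i<n2. F (LengthY i)) + (\<Sum>i<n3. F (LengthZ i)) + F Direction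
     + (\<Sum>k\<in>UNIV. F (StartX k)) + (\<Sum>k\<in>UNIV. F (StartY k)) + (\<Sum>k\<in>UNIV. F (StartZ k))
     + (\<Sum>k\<in>UNIV. F (CloseXY k)) + (\<Sum>k\<in>UNIV. F (CloseYZ k))"
proof -
  have U: "sum F (A \<union> B) = a + b"
    if "finite A" "finite B" "A \<inter> B = {}" "sum F A = a" "sum F B = b" for A B a b
    using that sum.union_disjoint by blast
  show ?thesis
    unfolding linkage_constraints_def by (intro U) (auto simp: sum.reindex inj_on_def)
qed

lemma card_linkage_constraints: "card (linkage_constraints n1 n2 n3) = n1 + n2 + n3 + 11"
  using sum_linkage_constraints[of "\<lambda>_. 1 :: nat" n1 n2 n3] by simp

context
  fixes d1 d2 d3 :: "real list"
begin

text \<open>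
  The equations that cut out the normalised configurations; lengths enter squared, to be polynomial.
\<close>

fun defect :: "linkage_constraint \<Rightarrow>
    ('u::{finite,linorder}, 'v::{finite,linorder}, 'w::{finite,linorder}) triple \<Rightarrow> real" where
  "defect (LengthX i) = (\<lambda>q. edge i (fst q) \<bullet> edge i (fst q) - (d1 ! i)\<^sup>2)"
| "defect (LengthY i) = (\<lambda>q. edge i (fst (snd q)) \<bullet> edge i (fst (snd q)) - (d2 ! i)\<^sup>2)"
| "defect (LengthZ i) = (\<lambda>q. edge i (snd (snd q)) \<bullet> edge i (snd (snd q)) - (d3 ! i)\<^sup>2)"
| "defect Direction = (\<lambda>q. edge 0 (fst q) $ 2)"
| "defect (StartX k) = (\<lambda>q. fst q $ vertex 0 $ k)"
| "defect (StartY k) = (\<lambda>q. fst (snd q) $ vertex 0 $ k)"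
| "defect (StartZ k) = (\<lambda>q. snd (snd q) $ vertex 0 $ k)"
| "defect (CloseXY k) = (\<lambda>q. (fst q $ vertex (length d1) - fst (snd q) $ vertex (length d2)) $ k)"
| "defect (CloseYZ k) = (\<lambda>q. (fst (snd q) $ vertex (length d2) - snd (snd q) $ vertex (length d3)) $ k)"

fun defect_deriv :: "linkage_constraint \<Rightarrow>
    ('u::{finite,linorder}, 'v::{finite,linorder}, 'w::{finite,linorder}) triple \<Rightarrow>
    ('u, 'v, 'w) triple \<Rightarrow> real" where
  "defect_deriv (LengthX i) p = (\<lambda>v. 2 * (edge i (fst p) \<bullet> edge i (fst v)))"
| "defect_deriv (LengthY i) p = (\<lambda>v. 2 * (edge i (fst (snd p)) \<bullet> edge i (fst (snd v))))"
| "defect_deriv (LengthZ i) p = (\<lambda>v. 2 * (edge i (snd (snd p)) \<bullet> edge i (snd (snd v))))"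
| "defect_deriv j p = defect j"

lemma has_derivative_inner_self:
  fixes L :: "'a::real_normed_vector \<Rightarrow> 'b::real_inner"
  assumes "bounded_linear L"
  shows "((\<lambda>q. L q \<bullet> L q - c) has_derivative (\<lambda>v. 2 * (L p \<bullet> L v))) (at p)"
  by (auto intro!: derivative_eq_intros bounded_linear_imp_has_derivative[OF assms] simp: inner_commute)

lemma smooth_on_inner_self:
  fixes L :: "'a::euclidean_space \<Rightarrow> 'b::euclidean_space"
  assumes "bounded_linear L" "open S"
  shows "smooth_on S (\<lambda>q. L q \<bullet> L q - c)"
  unfolding smooth_on_def diff_conv_add_uminus
  by (intro allI ck_on_add ck_on_inner ck_on_const ck_on_bounded_linear assms)

lemma bounded_linear_edges:
  "bounded_linear (\<lambda>q. edge i (fst q))"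
  "bounded_linear (\<lambda>q. edge i (fst (snd q)))"
  "bounded_linear (\<lambda>q. edge i (snd (snd q)))"
  by (intro bounded_linear_compose[OF bounded_linear_edge] bounded_linear_intros)+

lemma linear_defect:
  assumes "j \<notin> range LengthX \<union> range LengthY \<union> range LengthZ"
  shows "bounded_linear (defect j)"
  using assms
  by (cases j) (auto simp del: vector_minus_component
      intro!: bounded_linear_component bounded_linear_edges bounded_linear_intros)

lemma has_derivative_defect: "(defect j has_derivative defect_deriv j p) (at p)"
proof (cases "j \<in> range LengthX \<union> range LengthY \<union> range LengthZ")
  case True
  then show ?thesis
    by (auto intro!: has_derivative_inner_self bounded_linear_edges)
next
  case False
  then have "defect_deriv j p = defect j" by (cases j) auto
  then show ?thesis using bounded_linear_imp_has_derivative[OF linear_defect[OF False]] by simp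
qed

lemma smooth_on_defect:
  assumes "open S" shows "smooth_on S (defect j)"
proof (cases "j \<in> range LengthX \<union> range LengthY \<union> range LengthZ")
  case True
  then show ?thesis
    by (auto intro!: smooth_on_inner_self bounded_linear_edges assms)
next
  case False
  then show ?thesis using ck_on_bounded_linear[OF assms linear_defect] by (simp add: smooth_on_def)
qed

text \<open>
  Since the prescribed lengths are positive, the squared equations determine the lengths.
\<close>

lemma normalised_configurations_eq_zero_set:
  assumes "\<And>d. d \<in> set d1 \<union> set d2 \<union> set d3 \<Longrightarrow> d > 0"
  shows "normalised_configurations d1 d2 d3 =
     {q. first_edge q $ 1 > 0 \<and>
       (\<forall>j\<in>linkage_constraints (length d1) (length d2) (length d3). defect j q = 0)}"
proof -
  have sq: "dist u v = r \<longleftrightarrow> (v - u) \<bullet> (v - u) = r\<^sup>2" if "r > 0" for u v :: "real^2" and r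
  proof -
    have "dist u v = r \<longleftrightarrow> (dist u v)\<^sup>2 = r\<^sup>2" using that by (simp add: power2_eq_iff_nonneg)
    then show ?thesis by (simp add: dist_norm norm_minus_commute[of u v] power2_norm_eq_inner)
  qed
  have len: "x \<in> configurations d \<longleftrightarrow> (\<forall>i<length d. edge i x \<bullet> edge i x = (d ! i)\<^sup>2)"
    if "\<And>r. r \<in> set d \<Longrightarrow> r > 0" for d and x :: "(real^2)^'v::{finite,linorder}"
    unfolding configurations_def edge_def mem_Collect_eq using sq that nth_mem by metis
  show ?thesis
  proof (intro set_eqI)
    fix q
    show "q \<in> normalised_configurations d1 d2 d3 \<longleftrightarrow>
      q \<in> {q. first_edge q $ 1 > 0 \<and> (\<forall>j\<in>linkage_constraints (length d1) (length d2) (length d3). defect j q = 0)}"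
      by (cases q)
        (auto simp: normalised_configurations_def configuration_space_def len assms
          first_edge_on_positive_x_axis_iff first_edge_def edge_def initial_vertex_def terminal_vertex_def
          linkage_constraints_def ball_Un vec_eq_iff[where 'b = 2] forall_2)
  qed
qed

end

text \<open>
  The infinitesimal motion that translates by \<open>w\<close> all vertices after \<open>vertex m\<close>. It changes edge \<open>m\<close>
  and no other, so it isolates a single summand of a linear relation between the differentials.
\<close>

definition bend :: "nat \<Rightarrow> real^2 \<Rightarrow> (real^2)^'v::{finite,linorder}" where
  "bend m w = (\<chi> v. if v \<in> vertex ` {..m} then 0 else w)"

lemma bend_nth_vertex:
  assumes "CARD('v::{finite,linorder}) = n + 1" "i \<le> n" "m < n"
  shows "(bend m w :: (real^2)^'v::{finite,linorder}) $ vertex i = (if i \<le> m then 0 else w)"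
  using assms by (auto simp: bend_def vertex_eq_iff)

lemma edge_bend:
  assumes "CARD('v::{finite,linorder}) = n + 1" "i < n" "m < n"
  shows "edge i (bend m w :: (real^2)^'v::{finite,linorder}) = (if i = m then w else 0)"
  using assms by (auto simp: edge_def bend_nth_vertex[OF assms(1)])

lemma edge_zero: "edge i 0 = 0"
  by (simp add: edge_def)

lemma edge_translation: "edge i (\<chi> v. w) = 0"
  by (simp add: edge_def)

lemma eq_zero_if_inner_eq_zero: "(\<And>w. u \<bullet> w = 0) \<Longrightarrow> u = 0" for u :: "'a::real_inner"
  using inner_eq_zero_iff by blast

text \<open>
  A relation between the differentials of the constraints, with coefficients \<open>c\<close>, is an equilibrium of
  forces. Testing it against \<open>bend\<close> gives the force in each edge in terms of the multipliers \<open>\<alpha>\<close> and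
  \<open>\<beta>\<close> of the closing conditions; \<open>no_stress\<close> makes these vanish, and then all edge forces do. What
  is left are the forces that fix the initial vertices, which translations detect.
\<close>

lemma regular_linkage_constraints:
  fixes x :: "(real^2)^'u::{finite,linorder}" and y :: "(real^2)^'v::{finite,linorder}"
    and z :: "(real^2)^'w::{finite,linorder}"
  defines "p \<equiv> (x, y, z)"
  assumes card: "CARD('u) = length d1 + 1" "CARD('v) = length d2 + 1" "CARD('w) = length d3 + 1"
    and "d1 \<noteq> []" and pos: "\<And>d. d \<in> set d1 \<union> set d2 \<union> set d3 \<Longrightarrow> d > 0"
    and p: "p \<in> normalised_configurations d1 d2 d3"
    and no_stress: "\<And>\<alpha> \<beta> cx cy cz. \<lbrakk>\<And>i. 0 < i \<Longrightarrow> i < length d1 \<Longrightarrow> cx i *\<^sub>R edge i x = - \<alpha>;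
        \<And>i. i < length d2 \<Longrightarrow> cy i *\<^sub>R edge i y = \<alpha> - \<beta>; \<And>i. i < length d3 \<Longrightarrow> cz i *\<^sub>R edge i z = \<beta>\<rbrakk>
      \<Longrightarrow> \<alpha> = 0 \<and> \<beta> = 0"
    and lin: "\<And>v. (\<Sum>j\<in>linkage_constraints (length d1) (length d2) (length d3).
        c j * defect_deriv d1 d2 d3 j p v) = 0"
    and j: "j \<in> linkage_constraints (length d1) (length d2) (length d3)"
  shows "c j = 0"
proof -
  let ?n1 = "length d1" and ?n2 = "length d2" and ?n3 = "length d3"
  define sx sy sz where "sx = (\<chi> k. c (StartX k))" "sy = (\<chi> k. c (StartY k))" "sz = (\<chi> k. c (StartZ k))"
  define \<alpha> \<beta> where "\<alpha> = (\<chi> k. c (CloseXY k))" "\<beta> = (\<chi> k. c (CloseYZ k))"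
  define cx cy cz where "cx = (\<lambda>i. 2 * c (LengthX i))" "cy = (\<lambda>i. 2 * c (LengthY i))" "cz = (\<lambda>i. 2 * c (LengthZ i))"
  have balance: "(\<Sum>i<?n1. cx i * (edge i x \<bullet> edge i \<xi>)) + (\<Sum>i<?n2. cy i * (edge i y \<bullet> edge i \<eta>))
      + (\<Sum>i<?n3. cz i * (edge i z \<bullet> edge i \<zeta>)) + c Direction * edge 0 \<xi> $ 2
      + sx \<bullet> \<xi> $ vertex 0 + sy \<bullet> \<eta> $ vertex 0 + sz \<bullet> \<zeta> $ vertex 0
      + \<alpha> \<bullet> (\<xi> $ vertex ?n1 - \<eta> $ vertex ?n2) + \<beta> \<bullet> (\<eta> $ vertex ?n2 - \<zeta> $ vertex ?n3) = 0"
    for \<xi> :: "(real^2)^'u::{finite,linorder}" and \<eta> :: "(real^2)^'v::{finite,linorder}"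
      and \<zeta> :: "(real^2)^'w::{finite,linorder}"
    using lin[of "(\<xi>, \<eta>, \<zeta>)"]
    by (simp add: sum_linkage_constraints p_def sx_sy_sz_def \<alpha>_\<beta>_def cx_cy_cz_def inner_vec_def mult_ac
        del: vector_minus_component)
  have X: "cx m *\<^sub>R edge m x + (if m = 0 then c Direction *\<^sub>R axis 2 1 else 0) + \<alpha> = 0" if "m < ?n1" for m
  proof (rule eq_zero_if_inner_eq_zero)
    fix w
    show "(cx m *\<^sub>R edge m x + (if m = 0 then c Direction *\<^sub>R axis 2 1 else 0) + \<alpha>) \<bullet> w = 0"
      using balance[of "bend m w" 0 0] that \<open>d1 \<noteq> []\<close>
      by (cases "m = 0")
        (simp_all add: edge_zero edge_bend[OF card(1)] bend_nth_vertex[OF card(1)] inner_add_left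
          if_distrib[of "\<lambda>u. edge _ x \<bullet> u"] if_distrib[of "\<lambda>r. cx _ * r"] inner_axis' cong: if_cong)
  qed
  have Y: "cy m *\<^sub>R edge m y + \<beta> - \<alpha> = 0" if "m < ?n2" for m
  proof (rule eq_zero_if_inner_eq_zero)
    fix w
    show "(cy m *\<^sub>R edge m y + \<beta> - \<alpha>) \<bullet> w = 0"
      using balance[of 0 "bend m w" 0] that
      by (simp add: edge_zero edge_bend[OF card(2)] bend_nth_vertex[OF card(2)] inner_add_left inner_diff_left
          if_distrib[of "\<lambda>u. edge _ y \<bullet> u"] if_distrib[of "\<lambda>r. cy _ * r"] cong: if_cong)
  qed
  have Z: "cz m *\<^sub>R edge m z - \<beta> = 0" if "m < ?n3" for m
  proof (rule eq_zero_if_inner_eq_zero)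
    fix w
    show "(cz m *\<^sub>R edge m z - \<beta>) \<bullet> w = 0"
      using balance[of 0 0 "bend m w"] that
      by (simp add: edge_zero edge_bend[OF card(3)] bend_nth_vertex[OF card(3)] inner_add_left inner_diff_left
          if_distrib[of "\<lambda>u. edge _ z \<bullet> u"] if_distrib[of "\<lambda>r. cz _ * r"] cong: if_cong)
  qed
  have "\<alpha> = 0 \<and> \<beta> = 0"
  proof (rule no_stress)
    show "cx i *\<^sub>R edge i x = - \<alpha>" if "0 < i" "i < ?n1" for i
      using X[OF that(2)] that(1) by (simp add: eq_neg_iff_add_eq_0)
    show "cy i *\<^sub>R edge i y = \<alpha> - \<beta>" if "i < ?n2" for i using Y[OF that] by (simp add: algebra_simps)
    show "cz i *\<^sub>R edge i z = \<beta>" if "i < ?n3" for i using Z[OF that] by simp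
  qed
  then have \<alpha>\<beta>: "\<alpha> = 0" "\<beta> = 0" by auto
  have "sx \<bullet> w = 0" "sy \<bullet> w = 0" "sz \<bullet> w = 0" for w
    using balance[of "\<chi> v. w" 0 0] balance[of 0 "\<chi> v. w" 0] balance[of 0 0 "\<chi> v. w"]
    by (simp_all add: edge_zero edge_translation \<alpha>\<beta>)
  then have s: "sx = 0" "sy = 0" "sz = 0" by (auto intro: eq_zero_if_inner_eq_zero)
  have zero: "defect d1 d2 d3 j p = 0" if "j \<in> linkage_constraints ?n1 ?n2 ?n3" for j
    using p that by (subst (asm) normalised_configurations_eq_zero_set) (auto intro: pos)
  have nonzero_x: "edge i x \<noteq> 0" if "i < ?n1" for i
  proof -
    have "edge i x \<bullet> edge i x = (d1 ! i)\<^sup>2"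
      using zero[of "LengthX i"] that by (simp add: linkage_constraints_def p_def)
    moreover have "d1 ! i > 0" using pos that by simp
    ultimately show ?thesis by auto
  qed
  have nonzero_y: "edge i y \<noteq> 0" if "i < ?n2" for i
  proof -
    have "edge i y \<bullet> edge i y = (d2 ! i)\<^sup>2"
      using zero[of "LengthY i"] that by (simp add: linkage_constraints_def p_def)
    moreover have "d2 ! i > 0" using pos that by simp
    ultimately show ?thesis by auto
  qed
  have nonzero_z: "edge i z \<noteq> 0" if "i < ?n3" for i
  proof -
    have "edge i z \<bullet> edge i z = (d3 ! i)\<^sup>2"
      using zero[of "LengthZ i"] that by (simp add: linkage_constraints_def p_def)
    moreover have "d3 ! i > 0" using pos that by simp
    ultimately show ?thesis by auto
  qed
  have e: "edge 0 x $ 1 > 0" "edge 0 x $ 2 = 0"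
    using p by (simp_all add: p_def normalised_configurations_def first_edge_on_positive_x_axis_iff first_edge_def edge_def)
  have X0: "cx 0 *\<^sub>R edge 0 x + c Direction *\<^sub>R axis 2 1 = 0"
    using X[of 0] \<open>d1 \<noteq> []\<close> \<alpha>\<beta> by simp
  \<comment> \<open>The first edge is along the positive axis and \<open>Direction\<close> acts across it, so the two
    contributions to this force balance are independent.\<close>
  have D: "cx 0 = 0" "c Direction = 0"
    using arg_cong[OF X0, of "\<lambda>v. v $ 1"] arg_cong[OF X0, of "\<lambda>v. v $ 2"] e by (simp_all add: axis_def)
  have lengths: "i < ?n1 \<Longrightarrow> cx i = 0" "i < ?n2 \<Longrightarrow> cy i = 0" "i < ?n3 \<Longrightarrow> cz i = 0" for i
    using X[of i] Y[of i] Z[of i] \<alpha>\<beta> D nonzero_x nonzero_y nonzero_z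
    by (cases "i = 0"; simp)+
  have vectors: "c (StartX k) = sx $ k" "c (StartY k) = sy $ k" "c (StartZ k) = sz $ k"
      "c (CloseXY k) = \<alpha> $ k" "c (CloseYZ k) = \<beta> $ k" for k
    by (simp_all add: sx_sy_sz_def \<alpha>_\<beta>_def)
  have "i < ?n1 \<Longrightarrow> c (LengthX i) = 0" "i < ?n2 \<Longrightarrow> c (LengthY i) = 0" "i < ?n3 \<Longrightarrow> c (LengthZ i) = 0" for i
    using lengths[of i] by (simp_all add: cx_cy_cz_def)
  then show "c j = 0"
    using j D(2) by (cases j) (auto simp: linkage_constraints_def vectors s \<alpha>\<beta>)
qed

text \<open>
  The condition \<open>no_stress\<close> says that at no configuration can nonzero forces \<open>- \<alpha>\<close>, \<open>\<alpha> - \<beta>\<close> and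
  \<open>\<beta>\<close>, which balance where the linkages meet, be transmitted along the three linkages. The first edge
  of the first linkage is exempt: its direction is held fixed and can absorb the rest of the force.
\<close>

theorem smooth_manifold_via_moduli_space:
  fixes d1 d2 d3 :: "real list"
  assumes card: "CARD('u::{finite,linorder}) = length d1 + 1" "CARD('v::{finite,linorder}) = length d2 + 1"
      "CARD('w::{finite,linorder}) = length d3 + 1"
    and "d1 \<noteq> []" and pos: "\<And>d. d \<in> set d1 \<union> set d2 \<union> set d3 \<Longrightarrow> d > 0"
    and no_stress: "\<And>(x :: (real^2)^'u::{finite,linorder}) (y :: (real^2)^'v::{finite,linorder})
          (z :: (real^2)^'w::{finite,linorder}) \<alpha> \<beta> cx cy cz.
        \<lbrakk>(x, y, z) \<in> normalised_configurations d1 d2 d3;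
         \<And>i. 0 < i \<Longrightarrow> i < length d1 \<Longrightarrow> cx i *\<^sub>R edge i x = - \<alpha>;
         \<And>i. i < length d2 \<Longrightarrow> cy i *\<^sub>R edge i y = \<alpha> - \<beta>;
         \<And>i. i < length d3 \<Longrightarrow> cz i *\<^sub>R edge i z = \<beta>\<rbrakk>
      \<Longrightarrow> \<alpha> = 0 \<and> \<beta> = 0"
  shows "smooth_manifold_via (moduli_space d1 d2 d3 :: ('u, 'v, 'w) triple set topology) normal_form
           (int (length d1) + int (length d2) + int (length d3) - 5)"
proof -
  let ?N = "normalised_configurations d1 d2 d3 :: ('u, 'v, 'w) triple set"
  let ?W = "{q :: ('u, 'v, 'w) triple. first_edge q $ 1 > 0}"
  let ?I = "linkage_constraints (length d1) (length d2) (length d3)"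
  have N: "?N = {q \<in> ?W. \<forall>j\<in>?I. defect d1 d2 d3 j q = 0}"
    using normalised_configurations_eq_zero_set[OF pos] by auto
  have "open ?W" unfolding first_edge_def by (intro open_Collect_less continuous_intros)
  have "smooth_submanifold {q \<in> ?W. \<forall>j\<in>?I. defect d1 d2 d3 j q = 0}
      (int DIM(('u, 'v, 'w) triple) - int (card ?I))"
  proof (rule smooth_submanifold_regular_zero_set[OF finite_linkage_constraints \<open>open ?W\<close> smooth_on_defect[OF \<open>open ?W\<close>]])
    fix p c j
    assume p: "p \<in> ?W" "\<And>j. j \<in> ?I \<Longrightarrow> defect d1 d2 d3 j p = 0" and j: "j \<in> ?I"
      and lin: "\<And>v. (\<Sum>j\<in>?I. c j * frechet_derivative (defect d1 d2 d3 j) (at p) v) = 0"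
    obtain x y z where xyz: "p = (x, y, z)" by (cases p)
    have xyzN: "(x, y, z) \<in> ?N" using p unfolding N xyz by blast
    have lin': "(\<Sum>j\<in>?I. c j * defect_deriv d1 d2 d3 j (x, y, z) v) = 0" for v
      using lin[of v] xyz by (simp flip: frechet_derivative_at[OF has_derivative_defect])
    show "c j = 0"
      by (rule regular_linkage_constraints[OF card \<open>d1 \<noteq> []\<close> _ xyzN _ lin' j])
        (use pos no_stress[OF xyzN] in blast)+
  qed
  moreover have "int DIM(('u, 'v, 'w) triple) - int (card ?I)
      = int (length d1) + int (length d2) + int (length d3) - 5"
    by (simp add: card card_linkage_constraints)
  ultimately have "smooth_submanifold ?N (int (length d1) + int (length d2) + int (length d3) - 5)"
    using N by simp
  moreover have "hd d1 > 0" using pos \<open>d1 \<noteq> []\<close> by auto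
  ultimately show ?thesis
    unfolding smooth_manifold_via_def using \<open>d1 \<noteq> []\<close> by (simp add: moduli_space_normal_form)
qed

section \<open>Folded linkages and parity\<close>

text \<open>
  Each \<open>e i\<close> is plus or minus the unit vector \<open>sgn u\<close>, so the sum is that vector times a sum of signs.
\<close>

lemma sum_parallel_unit_vectors:
  fixes e :: "'i \<Rightarrow> 'a::real_normed_vector"
  assumes "finite J" "\<And>i. i \<in> J \<Longrightarrow> norm (e i) = 1" "\<And>i. i \<in> J \<Longrightarrow> c i *\<^sub>R e i = u" "u \<noteq> 0"
  obtains k :: int where "(\<Sum>i\<in>J. e i) = of_int k *\<^sub>R sgn u" "even k \<longleftrightarrow> even (card J)"
proof -
  have "\<exists>k :: int. (\<Sum>i\<in>J. e i) = of_int k *\<^sub>R sgn u \<and> (even k \<longleftrightarrow> even (card J))"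
    using assms(1-3)
  proof (induction J)
    case empty
    then show ?case by (intro exI[of _ 0]) simp
  next
    case (insert i J)
    then obtain k :: int where k: "(\<Sum>i\<in>J. e i) = of_int k *\<^sub>R sgn u" "even k \<longleftrightarrow> even (card J)"
      by auto
    have ci: "u = c i *\<^sub>R e i" "norm (e i) = 1" using insert.prems by auto
    have "sgn u = sgn (c i) *\<^sub>R e i"
      using ci by (simp add: sgn_div_norm sgn_scaleR)
    moreover have "c i \<noteq> 0" using ci(1) assms(4) by auto
    ultimately have e: "e i = sgn (c i) *\<^sub>R sgn u" by (simp add: sgn_if)
    show ?case
    proof (intro exI conjI)
      show "(\<Sum>i\<in>insert i J. e i) = of_int (k + (if c i > 0 then 1 else - 1)) *\<^sub>R sgn u"
        using insert.hyps k(1) e \<open>c i \<noteq> 0\<close> by (simp add: scaleR_add_left sgn_if)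
      show "even (k + (if c i > 0 then 1 else - 1)) \<longleftrightarrow> even (card (insert i J))"
        using insert.hyps k(2) by simp
    qed
  qed
  then show thesis using that by blast
qed

lemma sum_edges: "(\<Sum>i<n. edge i x) = x $ vertex n - x $ vertex 0"
  unfolding edge_def using sum_lessThan_telescope[of "\<lambda>i. x $ vertex i" n] by simp

theorem theorem5p1:
  fixes n1 n2 n3 :: nat and a :: real
  assumes "n1 > 0" and "n2 > 0" and "n3 > 0" and "a > 0"
    and "CARD('u::{finite,linorder}) = n1 + 1"
    and "CARD('v::{finite,linorder}) = n2 + 1"
    and "CARD('w::{finite,linorder}) = n3 + 1"
    and "even n2 \<noteq> even n3"
    and "a \<in> {0<..<real (min n2 n3)} - \<int>"
  shows "smooth_manifold_via
           (moduli_space (a # replicate (n1 - 1) 1) (replicate n2 1) (replicate n3 1)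
              :: ('u, 'v, 'w) triple set topology)
           normal_form
           (int n1 + int n2 + int n3 - 5)"
proof -
  let ?d1 = "a # replicate (n1 - 1) 1" and ?d2 = "replicate n2 (1 :: real)" and ?d3 = "replicate n3 (1 :: real)"
  have n: "length ?d1 = n1" "length ?d2 = n2" "length ?d3 = n3" using assms(1) by simp_all
  have "smooth_manifold_via (moduli_space ?d1 ?d2 ?d3 :: ('u, 'v, 'w) triple set topology) normal_form
      (int (length ?d1) + int (length ?d2) + int (length ?d3) - 5)"
  proof (rule smooth_manifold_via_moduli_space)
    fix x :: "(real^2)^'u::{finite,linorder}" and y :: "(real^2)^'v::{finite,linorder}"
      and z :: "(real^2)^'w::{finite,linorder}" and \<alpha> \<beta> :: "real^2" and cx cy cz
    assume p: "(x, y, z) \<in> normalised_configurations ?d1 ?d2 ?d3"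
      and cx: "\<And>i. 0 < i \<Longrightarrow> i < length ?d1 \<Longrightarrow> cx i *\<^sub>R edge i x = - \<alpha>"
      and cy: "\<And>i. i < length ?d2 \<Longrightarrow> cy i *\<^sub>R edge i y = \<alpha> - \<beta>"
      and cz: "\<And>i. i < length ?d3 \<Longrightarrow> cz i *\<^sub>R edge i z = \<beta>"
    have p': "\<And>i. i < n1 \<Longrightarrow> norm (edge i x) = ?d1 ! i" "\<And>i. i < n2 \<Longrightarrow> norm (edge i y) = 1"
        "\<And>i. i < n3 \<Longrightarrow> norm (edge i z) = 1"
        "x $ vertex 0 = 0" "y $ vertex 0 = 0" "z $ vertex 0 = 0"
        "x $ vertex n1 = y $ vertex n2" "y $ vertex n2 = z $ vertex n3"
      using p assms(1) n
      by (auto simp: normalised_configurations_def configuration_space_def configurations_def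
          initial_vertex_def terminal_vertex_def edge_def dist_norm norm_minus_commute)
    have Sy: "(\<Sum>i<n2. edge i y) = x $ vertex n1" and Sz: "(\<Sum>i<n3. edge i z) = x $ vertex n1"
      by (simp_all add: sum_edges p')
    have Sx: "edge 0 x + (\<Sum>i\<in>{0<..<n1}. edge i x) = x $ vertex n1"
    proof -
      have "{..<n1} = insert 0 {0<..<n1}" using assms(1) by auto
      then have "edge 0 x + (\<Sum>i\<in>{0<..<n1}. edge i x) = (\<Sum>i<n1. edge i x)" by simp
      then show ?thesis by (simp add: sum_edges p')
    qed
    \<comment> \<open>If the linkage \<open>f\<close> is folded along the line of \<open>\<alpha>\<close>, as the unit edges of the first linkage are,
      then the edge of length \<open>a\<close> is an integer multiple of \<open>sgn \<alpha>\<close>.\<close>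
    have not_aligned: False
      if nz: "\<alpha> \<noteq> 0" and J: "finite J" "\<And>i. i \<in> J \<Longrightarrow> norm (f i) = 1" "\<And>i. i \<in> J \<Longrightarrow> c i *\<^sub>R f i = \<alpha>"
        "(\<Sum>i\<in>J. f i) = x $ vertex n1" for J :: "nat set" and f c
    proof -
      obtain m :: int where m: "(\<Sum>i\<in>{0<..<n1}. edge i x) = of_int m *\<^sub>R sgn (- \<alpha>)"
        by (rule sum_parallel_unit_vectors[of "{0<..<n1}" "\<lambda>i. edge i x" cx "- \<alpha>"])
          (use cx n p'(1) nz in \<open>auto simp: nth_Cons'\<close>)
      obtain l :: int where l: "(\<Sum>i\<in>J. f i) = of_int l *\<^sub>R sgn \<alpha>"
        using sum_parallel_unit_vectors[of J f c \<alpha>, OF J(1-3) nz] by blast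
      have "edge 0 x = of_int (l + m) *\<^sub>R sgn \<alpha>"
        using Sx m l J(4) by (simp add: algebra_simps sgn_minus)
      moreover have "norm (edge 0 x) = a" using p'(1)[OF assms(1)] by simp
      ultimately have "a = \<bar>of_int (l + m)\<bar>" using nz by (simp add: norm_sgn)
      then show False using assms(9) by simp
    qed
    show "\<alpha> = 0 \<and> \<beta> = 0"
    proof (rule ccontr)
      assume nz: "\<not> (\<alpha> = 0 \<and> \<beta> = 0)"
      show False
      proof (cases "\<beta> = 0 \<or> \<alpha> = \<beta>")
        case True
        then show False
        proof
          assume "\<beta> = 0"
          then show False using nz not_aligned[of "{..<n2}" "\<lambda>i. edge i y" cy] p' cy Sy by simp
        next
          assume "\<alpha> = \<beta>"
          then show False using nz not_aligned[of "{..<n3}" "\<lambda>i. edge i z" cz] p' cz Sz by simp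
        qed
      next
        case False
        obtain k :: int where k: "(\<Sum>i<n2. edge i y) = of_int k *\<^sub>R sgn (\<alpha> - \<beta>)" "even k \<longleftrightarrow> even n2"
          by (rule sum_parallel_unit_vectors[of "{..<n2}" "\<lambda>i. edge i y" cy "\<alpha> - \<beta>"])
            (use cy p' False in auto)
        obtain l :: int where l: "(\<Sum>i<n3. edge i z) = of_int l *\<^sub>R sgn \<beta>" "even l \<longleftrightarrow> even n3"
          by (rule sum_parallel_unit_vectors[of "{..<n3}" "\<lambda>i. edge i z" cz \<beta>])
            (use cz p' False in auto)
        have "norm (of_int k *\<^sub>R sgn (\<alpha> - \<beta>)) = norm (of_int l *\<^sub>R sgn \<beta>)"
          using k(1) l(1) Sy Sz by metis
        then have "\<bar>real_of_int k\<bar> = \<bar>real_of_int l\<bar>" using False by (simp add: norm_sgn)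
        then have "\<bar>k\<bar> = \<bar>l\<bar>" by linarith
        then have "even k \<longleftrightarrow> even l" by (metis dvd_abs_iff)
        then show False using k(2) l(2) assms(8) by simp
      qed
    qed
  qed (use assms in auto)
  then show ?thesis unfolding n .
qed

end
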